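(* Let $(G,\mathcal{P})$ be a non-elementary relatively hyperbolic group with $G$ finitely generated, and let $H\le G$ be a subgroup. Assume that $\Lambda(H)\subsetneq\partial(G,\mathcal{P})$ and $$\omega_G^+(H):=\limsup_{R\to\infty}|H\cap B_G(R)|^{1/R}>1.$$ Then $(G,H)\notin\mathbf{SLC}_{\mathrm{subexp}}$.
   Context: Relative hyperbolicity is in the sense of Osin and Bowditch; $\partial(G,\mathcal{P})$ is the Bowditch boundary and $\Lambda(H)\subseteq\partial(G,\mathcal{P})$ is the limit set of $H$. $\ell$ is the word length on $G$ for a finite symmetric generating set and $B_G(R)=\{g\in G:\ell(g)\le R\}$. For $f\in\mathbb{C}G$, $\|f\|_{(2,1)}:=\bigl(\sum_{x\in G/H}(\sum_{g\in x}|f(g)|)^2\bigr)^{1/2}$ (sum over left cosets) and $\|f\|_h:=\sup\{\|f*\varphi\|_{(2,1)}:\varphi\in\mathbb{C}G,\ \|\varphi\|_{(2,1)}=1\}$. $(G,H)\in\mathbf{SLC}_{\mathrm{subexp}}$ means: there exist $C_h>0$ and $w:G\to[1,\infty)$ such that $\|f\|_h\le C_h\|fw\|_{(2,1)}$ for all $f\in\mathbb{C}G$ and $W(t):=\sup\{w(g):\ell(g)\le t\}$ satisfies $\lim_{t\to\infty}\frac{\log W(t)}{t}=0$. *)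

theory Defs
  imports "HOL-Analysis.Analysis" "HOL-Algebra.Group_Action" "HOL-Algebra.Left_Coset"
    "HOL-Algebra.Generated_Groups"
begin

section \<open>Proper hyperbolic geodesic spaces and their Gromov boundary\<close>

definition proper_space :: "'x::metric_space itself \<Rightarrow> bool" where
  "proper_space TYPE('x) \<longleftrightarrow> (\<forall>(x::'x) r. compact (cball x r))"

text \<open>For proper spaces, being geodesic is the same as being a path-metric (length) space, which is
  how Bowditch phrases it.\<close>

definition geodesic_space :: "'x::metric_space itself \<Rightarrow> bool" where
  "geodesic_space TYPE('x) \<longleftrightarrow>
     (\<forall>x y :: 'x. \<exists>\<gamma> :: real \<Rightarrow> 'x. \<gamma> 0 = x \<and> \<gamma> (dist x y) = y \<and>
        (\<forall>s \<in> {0..dist x y}. \<forall>t \<in> {0..dist x y}. dist (\<gamma> s) (\<gamma> t) = \<bar>s - t\<bar>))"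

definition gromov_product :: "'x::metric_space \<Rightarrow> 'x \<Rightarrow> 'x \<Rightarrow> real" where
  "gromov_product b x y = (dist b x + dist b y - dist x y) / 2"

definition hyperbolic_space :: "'x::metric_space itself \<Rightarrow> bool" where
  "hyperbolic_space TYPE('x) \<longleftrightarrow>
     (\<exists>\<delta>. \<forall>b x y z :: 'x.
        gromov_product b x z \<ge> min (gromov_product b x y) (gromov_product b y z) - \<delta>)"

text \<open>Gromov products for two base points \<open>b\<close>, \<open>b'\<close> differ by at most \<open>dist b b'\<close>, so the
  quantification over all base points below is immaterial; it only avoids choosing one.\<close>

definition converge_together :: "(nat \<Rightarrow> 'x::metric_space) \<Rightarrow> (nat \<Rightarrow> 'x) \<Rightarrow> bool" where
  "converge_together u v \<longleftrightarrow>
     (\<forall>b. filterlim (\<lambda>(i, j). gromov_product b (u i) (v j)) at_top (sequentially \<times>\<^sub>F sequentially))"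

definition gromov_sequences :: "(nat \<Rightarrow> 'x::metric_space) set" where
  "gromov_sequences = {u. converge_together u u}"

text \<open>A boundary point is an equivalence class of sequences converging at infinity; thus \<open>u \<in> \<xi>\<close> reads
  ``\<open>u\<close> converges to \<open>\<xi>\<close>''.\<close>

definition gromov_boundary :: "(nat \<Rightarrow> 'x::metric_space) set set" where
  "gromov_boundary =
     gromov_sequences // {(u, v). u \<in> gromov_sequences \<and> v \<in> gromov_sequences \<and> converge_together u v}"

definition boundary_nbhd ::
  "'x::metric_space \<Rightarrow> (nat \<Rightarrow> 'x) set \<Rightarrow> real \<Rightarrow> (nat \<Rightarrow> 'x) set set" where
  "boundary_nbhd b \<xi> r =
     {\<eta> \<in> gromov_boundary. \<exists>u \<in> \<xi>. \<exists>v \<in> \<eta>.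
        eventually (\<lambda>(i, j). gromov_product b (u i) (v j) \<ge> r) (sequentially \<times>\<^sub>F sequentially)}"

definition boundary_open :: "(nat \<Rightarrow> 'x::metric_space) set set \<Rightarrow> bool" where
  "boundary_open S \<longleftrightarrow>
     S \<subseteq> gromov_boundary \<and> (\<forall>b. \<forall>\<xi> \<in> S. \<exists>r. boundary_nbhd b \<xi> r \<subseteq> S)"

definition boundary_topology :: "(nat \<Rightarrow> 'x::metric_space) set topology" where
  "boundary_topology = topology boundary_open"

lemma boundary_nbhd_antimono: "r \<le> s \<Longrightarrow> boundary_nbhd b \<xi> s \<subseteq> boundary_nbhd b \<xi> r"
proof
  fix \<eta> assume rs: "r \<le> s" and "\<eta> \<in> boundary_nbhd b \<xi> s"
  then obtain u v where uv: "\<eta> \<in> gromov_boundary" "u \<in> \<xi>" "v \<in> \<eta>"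
    and ev: "eventually (\<lambda>(i, j). gromov_product b (u i) (v j) \<ge> s) (sequentially \<times>\<^sub>F sequentially)"
    unfolding boundary_nbhd_def by blast
  from ev have "eventually (\<lambda>(i, j). gromov_product b (u i) (v j) \<ge> r) (sequentially \<times>\<^sub>F sequentially)"
    by (rule eventually_mono) (use rs in auto)
  with uv show "\<eta> \<in> boundary_nbhd b \<xi> r"
    unfolding boundary_nbhd_def by blast
qed

lemma istopology_boundary_open: "istopology boundary_open"
proof -
  have "boundary_open (S \<inter> T)" if S: "boundary_open S" and T: "boundary_open T"
    for S T :: "(nat \<Rightarrow> 'a) set set"
    unfolding boundary_open_def
  proof (intro conjI allI ballI)
    show "S \<inter> T \<subseteq> gromov_boundary"
      using S by (auto simp: boundary_open_def)
    fix b \<xi> assume "\<xi> \<in> S \<inter> T"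
    then obtain r s where "boundary_nbhd b \<xi> r \<subseteq> S" "boundary_nbhd b \<xi> s \<subseteq> T"
      using S T unfolding boundary_open_def by blast
    then have "boundary_nbhd b \<xi> (max r s) \<subseteq> S \<inter> T"
      using boundary_nbhd_antimono[of r "max r s" b \<xi>] boundary_nbhd_antimono[of s "max r s" b \<xi>]
      by auto
    then show "\<exists>r. boundary_nbhd b \<xi> r \<subseteq> S \<inter> T" ..
  qed
  moreover have "boundary_open (\<Union>K)" if K: "\<forall>S\<in>K. boundary_open S"
    for K :: "(nat \<Rightarrow> 'a) set set set"
    unfolding boundary_open_def
  proof (intro conjI allI ballI)
    show "\<Union>K \<subseteq> gromov_boundary"
      using K by (auto simp: boundary_open_def)
    fix b \<xi> assume "\<xi> \<in> \<Union>K"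
    then obtain S where "S \<in> K" "\<xi> \<in> S" by blast
    then obtain r where "boundary_nbhd b \<xi> r \<subseteq> S"
      using K unfolding boundary_open_def by blast
    with \<open>S \<in> K\<close> show "\<exists>r. boundary_nbhd b \<xi> r \<subseteq> \<Union>K" by blast
  qed
  ultimately show ?thesis
    by (simp add: istopology_def)
qed

lemma openin_boundary_topology: "openin boundary_topology S \<longleftrightarrow> boundary_open S"
  by (simp add: boundary_topology_def istopology_boundary_open)

definition boundary_map ::
  "('x::metric_space \<Rightarrow> 'x) \<Rightarrow> (nat \<Rightarrow> 'x) set \<Rightarrow> (nat \<Rightarrow> 'x) set" where
  "boundary_map f \<xi> = (\<lambda>u. f \<circ> u) ` \<xi>"

section \<open>Relatively hyperbolic groups\<close>

definition isometric_pd_action ::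
  "('g, 'm) monoid_scheme \<Rightarrow> ('g \<Rightarrow> 'x::metric_space \<Rightarrow> 'x) \<Rightarrow> bool" where
  "isometric_pd_action G \<phi> \<longleftrightarrow>
     group_action G UNIV \<phi> \<and>
     (\<forall>g \<in> carrier G. \<forall>x y. dist (\<phi> g x) (\<phi> g y) = dist x y) \<and>
     (\<forall>K. compact K \<longrightarrow> finite {g \<in> carrier G. \<phi> g ` K \<inter> K \<noteq> {}})"

definition limit_set ::
  "('g \<Rightarrow> 'x::metric_space \<Rightarrow> 'x) \<Rightarrow> 'g set \<Rightarrow> (nat \<Rightarrow> 'x) set set" where
  "limit_set \<phi> H =
     {\<xi> \<in> gromov_boundary. \<exists>x. \<exists>h :: nat \<Rightarrow> 'g. range h \<subseteq> H \<and> (\<lambda>n. \<phi> (h n) x) \<in> \<xi>}"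

definition loxodromic ::
  "('g, 'm) monoid_scheme \<Rightarrow> ('g \<Rightarrow> 'x::metric_space \<Rightarrow> 'x) \<Rightarrow> 'g \<Rightarrow> bool" where
  "loxodromic G \<phi> g \<longleftrightarrow>
     g \<in> carrier G \<and> (\<forall>n::nat. n > 0 \<longrightarrow> g [^]\<^bsub>G\<^esub> n \<noteq> \<one>\<^bsub>G\<^esub>) \<and>
     card {\<xi> \<in> gromov_boundary. boundary_map (\<phi> g) \<xi> = \<xi>} = 2"

definition parabolic_subgroup ::
  "('g, 'm) monoid_scheme \<Rightarrow> ('g \<Rightarrow> 'x::metric_space \<Rightarrow> 'x) \<Rightarrow> 'g set \<Rightarrow> bool" where
  "parabolic_subgroup G \<phi> Q \<longleftrightarrow>
     subgroup Q G \<and> infinite Q \<and>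
     (\<exists>\<xi> \<in> gromov_boundary. \<forall>g \<in> Q. boundary_map (\<phi> g) \<xi> = \<xi>) \<and>
     (\<forall>g \<in> Q. \<not> loxodromic G \<phi> g)"

definition maximal_parabolic_subgroup ::
  "('g, 'm) monoid_scheme \<Rightarrow> ('g \<Rightarrow> 'x::metric_space \<Rightarrow> 'x) \<Rightarrow> 'g set \<Rightarrow> bool" where
  "maximal_parabolic_subgroup G \<phi> Q \<longleftrightarrow>
     parabolic_subgroup G \<phi> Q \<and> (\<forall>Q'. parabolic_subgroup G \<phi> Q' \<and> Q \<subseteq> Q' \<longrightarrow> Q' = Q)"

definition bounded_parabolic_point ::
  "('g, 'm) monoid_scheme \<Rightarrow> ('g \<Rightarrow> 'x::metric_space \<Rightarrow> 'x) \<Rightarrow> (nat \<Rightarrow> 'x) set \<Rightarrow> bool" where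
  "bounded_parabolic_point G \<phi> \<xi> \<longleftrightarrow>
     (let Q = stabilizer G (\<lambda>g. boundary_map (\<phi> g)) \<xi> in
        \<xi> \<in> gromov_boundary \<and> parabolic_subgroup G \<phi> Q \<and>
        (\<exists>K. compactin boundary_topology K \<and> K \<subseteq> gromov_boundary - {\<xi>} \<and>
             (\<Union>g \<in> Q. boundary_map (\<phi> g) ` K) = gromov_boundary - {\<xi>}))"

definition geodesic_ray :: "(real \<Rightarrow> 'x::metric_space) \<Rightarrow> bool" where
  "geodesic_ray \<rho> \<longleftrightarrow> (\<forall>s \<ge> 0. \<forall>t \<ge> 0. dist (\<rho> s) (\<rho> t) = \<bar>s - t\<bar>)"

definition conical_limit_point ::
  "('g, 'm) monoid_scheme \<Rightarrow> ('g \<Rightarrow> 'x::metric_space \<Rightarrow> 'x) \<Rightarrow> (nat \<Rightarrow> 'x) set \<Rightarrow> bool" where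
  "conical_limit_point G \<phi> \<xi> \<longleftrightarrow>
     \<xi> \<in> gromov_boundary \<and>
     (\<exists>\<rho> x R. geodesic_ray \<rho> \<and> (\<lambda>n. \<rho> (real n)) \<in> \<xi> \<and>
        infinite {g \<in> carrier G. \<exists>t \<ge> 0. dist (\<phi> g x) (\<rho> t) \<le> R})"

definition finitely_generated_subgroup :: "('g, 'm) monoid_scheme \<Rightarrow> 'g set \<Rightarrow> bool" where
  "finitely_generated_subgroup G Q \<longleftrightarrow>
     subgroup Q G \<and> (\<exists>T. finite T \<and> T \<subseteq> Q \<and> generate G T = Q)"

definition conjugate_subgroups ::
  "('g, 'm) monoid_scheme \<Rightarrow> 'g set \<Rightarrow> 'g set \<Rightarrow> bool" where
  "conjugate_subgroups G Q P \<longleftrightarrow>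
     (\<exists>g \<in> carrier G. Q = (\<lambda>h. g \<otimes>\<^bsub>G\<^esub> h \<otimes>\<^bsub>G\<^esub> inv\<^bsub>G\<^esub> g) ` P)"

text \<open>Bowditch's definition of relative hyperbolicity via a properly discontinuous action on a proper
  hyperbolic space, with the witnessing action \<open>\<phi>\<close> as a parameter:  \<open>(G, \<P>)\<close> is relatively hyperbolic
  iff this holds for some action \<open>\<phi>\<close> on some space.  The space is a parameter because the Bowditch
  boundary of \<open>(G, \<P>)\<close> is by definition the Gromov boundary of such a space (all choices are
  \<open>G\<close>-equivariantly homeomorphic, by Bowditch).  The conventions on \<open>\<P>\<close> are Osin's:  \<open>\<P>\<close> is a finite
  family of subgroups, which may contain finite ones; its infinite members represent the conjugacy
  classes of maximal parabolic subgroups, each class exactly once.  Bowditch's conjugation-invariant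
  family consists of the conjugates of the infinite members of \<open>\<P>\<close>.\<close>

definition relatively_hyperbolic_via ::
  "('g, 'm) monoid_scheme \<Rightarrow> 'g set set \<Rightarrow> ('g \<Rightarrow> 'x::metric_space \<Rightarrow> 'x) \<Rightarrow> bool" where
  "relatively_hyperbolic_via G \<P> \<phi> \<longleftrightarrow>
     group G \<and>
     proper_space TYPE('x) \<and> geodesic_space TYPE('x) \<and> hyperbolic_space TYPE('x) \<and>
     isometric_pd_action G \<phi> \<and>
     (\<forall>\<xi> \<in> gromov_boundary. conical_limit_point G \<phi> \<xi> \<or> bounded_parabolic_point G \<phi> \<xi>) \<and>
     finite \<P> \<and>
     (\<forall>P \<in> \<P>. finitely_generated_subgroup G P) \<and>
     (\<forall>P \<in> \<P>. infinite P \<longrightarrow> maximal_parabolic_subgroup G \<phi> P) \<and>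
     (\<forall>Q. maximal_parabolic_subgroup G \<phi> Q \<longrightarrow> (\<exists>!P. P \<in> \<P> \<and> conjugate_subgroups G Q P))"

text \<open>As a set the boundary depends only on the space, i.e. on the type of \<open>\<phi>\<close>.\<close>

definition bowditch_boundary ::
  "('g \<Rightarrow> 'x::metric_space \<Rightarrow> 'x) \<Rightarrow> (nat \<Rightarrow> 'x) set set" where
  "bowditch_boundary \<phi> = gromov_boundary"

definition non_elementary :: "('g \<Rightarrow> 'x::metric_space \<Rightarrow> 'x) \<Rightarrow> bool" where
  "non_elementary \<phi> \<longleftrightarrow>
     infinite (bowditch_boundary \<phi>) \<or> card (bowditch_boundary \<phi>) > 2"

section \<open>Word length and relative growth\<close>

definition finite_symmetric_generating_set :: "('g, 'm) monoid_scheme \<Rightarrow> 'g set \<Rightarrow> bool" where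
  "finite_symmetric_generating_set G S \<longleftrightarrow>
     finite S \<and> S \<subseteq> carrier G \<and> (\<forall>s \<in> S. inv\<^bsub>G\<^esub> s \<in> S) \<and> generate G S = carrier G"

definition word_length :: "('g, 'm) monoid_scheme \<Rightarrow> 'g set \<Rightarrow> 'g \<Rightarrow> nat" where
  "word_length G S g =
     (LEAST n. \<exists>ws. set ws \<subseteq> S \<and> length ws = n \<and> foldr (\<otimes>\<^bsub>G\<^esub>) ws \<one>\<^bsub>G\<^esub> = g)"

definition word_ball :: "('g, 'm) monoid_scheme \<Rightarrow> 'g set \<Rightarrow> real \<Rightarrow> 'g set" where
  "word_ball G S R = {g \<in> carrier G. real (word_length G S g) \<le> R}"

definition relative_growth :: "('g, 'm) monoid_scheme \<Rightarrow> 'g set \<Rightarrow> 'g set \<Rightarrow> ereal" where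
  "relative_growth G S H =
     Limsup at_top (\<lambda>R::real. ereal (real (card (H \<inter> word_ball G S R)) powr (1 / R)))"

section \<open>The group algebra and the class SLC\<close>

definition group_algebra :: "('g, 'm) monoid_scheme \<Rightarrow> ('g \<Rightarrow> complex) set" where
  "group_algebra G = {f. finite {g. f g \<noteq> 0} \<and> {g. f g \<noteq> 0} \<subseteq> carrier G}"

definition convolution ::
  "('g, 'm) monoid_scheme \<Rightarrow> ('g \<Rightarrow> complex) \<Rightarrow> ('g \<Rightarrow> complex) \<Rightarrow> 'g \<Rightarrow> complex" where
  "convolution G f \<psi> g =
     (if g \<in> carrier G
      then \<Sum>h \<in> {h \<in> carrier G. f h \<noteq> 0}. f h * \<psi> (inv\<^bsub>G\<^esub> h \<otimes>\<^bsub>G\<^esub> g)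
      else 0)"

text \<open>The sums range over possibly infinite sets, but for elements of the group algebra only finitely
  many terms are nonzero.\<close>

definition norm21 :: "('g, 'm) monoid_scheme \<Rightarrow> 'g set \<Rightarrow> ('g \<Rightarrow> complex) \<Rightarrow> real" where
  "norm21 G H f =
     sqrt (\<Sum>\<^sub>\<infinity>X \<in> lcosets\<^bsub>G\<^esub> H. (\<Sum>\<^sub>\<infinity>g \<in> X. cmod (f g))\<^sup>2)"

text \<open>The supremum is over a nonempty set bounded by \<open>\<Sum>g. \<bar>f g\<bar>\<close>, since left translations permute
  the left cosets and hence preserve \<open>norm21\<close>.\<close>

definition norm_h :: "('g, 'm) monoid_scheme \<Rightarrow> 'g set \<Rightarrow> ('g \<Rightarrow> complex) \<Rightarrow> real" where
  "norm_h G H f =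
     Sup {norm21 G H (convolution G f \<psi>) | \<psi>. \<psi> \<in> group_algebra G \<and> norm21 G H \<psi> = 1}"

definition SLC_subexp :: "('g, 'm) monoid_scheme \<Rightarrow> 'g set \<Rightarrow> 'g set \<Rightarrow> bool" where
  "SLC_subexp G S H \<longleftrightarrow>
     (\<exists>C w. C > 0 \<and> (\<forall>g \<in> carrier G. w g \<ge> 1) \<and>
        (\<forall>f \<in> group_algebra G.
           norm_h G H f \<le> C * norm21 G H (\<lambda>g. f g * complex_of_real (w g))) \<and>
        ((\<lambda>t::real. ln (Sup (w ` word_ball G S t)) / t) \<longlongrightarrow> 0) at_top)"

end

theory Submission
  imports Defs
begin

text \<open>
  If \<open>H \<inter> tHt\<^sup>-\<^sup>1\<close> is finite for some \<open>t\<close>, let \<open>B = H \<inter> B\<^sub>G(R)\<close>. The indicator of \<open>Bt\<close> has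
  \<open>(2,1)\<close>-norm of order \<open>|B|\<^sup>1\<^sup>/\<^sup>2\<close>, while its convolution with the point mass at \<open>t\<^sup>-\<^sup>1\<close> is
  the indicator of \<open>B\<close>, of norm \<open>|B|\<close>. So SLC forces \<open>|B|\<^sup>1\<^sup>/\<^sup>2\<close> to grow subexponentially.

  To find \<open>t\<close>, take a boundary point \<open>\<xi> \<notin> \<Lambda>(H)\<close> and group elements \<open>g\<^sub>n\<close> with \<open>g\<^sub>n b \<rightarrow> \<xi>\<close> (every
  boundary point is conical or has an infinite stabilizer, hence is such a limit). Seen from
  \<open>g\<^sub>n b\<close>, the orbit \<open>Hb\<close> lies close to \<open>b\<close>. If \<open>H \<inter> tHt\<^sup>-\<^sup>1\<close> is infinite for \<open>t = g\<^sub>n s g\<^sub>n\<^sup>-\<^sup>1\<close>,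
  this bounds \<open>d(b, tb)\<close> independently of \<open>n\<close>. If that happened for every generator \<open>s\<close> and every
  \<open>n\<close>, then by properness only finitely many tuples \<open>(g\<^sub>n s g\<^sub>n\<^sup>-\<^sup>1)\<^sub>s\<close> would occur, so the center of
  \<open>G\<close> would be infinite. But central elements fix every boundary point, and the common stabilizer
  of three boundary points is finite.
\<close>

section \<open>Word length\<close>

context group
begin

lemma foldr_mult_closed:
  "set ws \<subseteq> carrier G \<Longrightarrow> foldr (\<otimes>) ws \<one> \<in> carrier G"
  by (induction ws) auto

lemma foldr_mult_append:
  "set ws \<subseteq> carrier G \<Longrightarrow> set vs \<subseteq> carrier G \<Longrightarrow>
    foldr (\<otimes>) (ws @ vs) \<one> = foldr (\<otimes>) ws \<one> \<otimes> foldr (\<otimes>) vs \<one>"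
  by (induction ws) (auto simp: m_assoc foldr_mult_closed)

lemma word_exists:
  assumes S: "finite_symmetric_generating_set G S" and g: "g \<in> carrier G"
  obtains ws where "set ws \<subseteq> S" "foldr (\<otimes>) ws \<one> = g"
proof -
  have SG: "S \<subseteq> carrier G" and S_inv: "\<And>s. s \<in> S \<Longrightarrow> inv s \<in> S"
    and gen: "generate G S = carrier G"
    using S unfolding finite_symmetric_generating_set_def by auto
  have "\<exists>ws. set ws \<subseteq> S \<and> foldr (\<otimes>) ws \<one> = g"
    using g unfolding gen[symmetric]
  proof (induction rule: generate.induct)
    case one
    show ?case by (rule exI[of _ "[]"]) simp
  next
    case (incl h)
    then show ?case using SG by (intro exI[of _ "[h]"]) auto
  next
    case (inv h)
    then show ?case using SG S_inv by (intro exI[of _ "[inv h]"]) auto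
  next
    case (eng h1 h2)
    then obtain ws vs where "set ws \<subseteq> S" "foldr (\<otimes>) ws \<one> = h1" "set vs \<subseteq> S" "foldr (\<otimes>) vs \<one> = h2"
      by blast
    then show ?case
      using SG foldr_mult_append[of ws vs] by (intro exI[of _ "ws @ vs"]) auto
  qed
  then show ?thesis using that by blast
qed

lemma word_length_witness:
  assumes "finite_symmetric_generating_set G S" "g \<in> carrier G"
  obtains ws where "set ws \<subseteq> S" "length ws = word_length G S g" "foldr (\<otimes>) ws \<one> = g"
proof -
  have "\<exists>n ws. set ws \<subseteq> S \<and> length ws = n \<and> foldr (\<otimes>) ws \<one> = g"
    using word_exists[OF assms] by metis
  from LeastI_ex[OF this] show ?thesis
    using that unfolding word_length_def by blast
qed

lemma word_length_mult_le:
  assumes S: "finite_symmetric_generating_set G S" and g: "g \<in> carrier G" and h: "h \<in> carrier G"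
  shows "word_length G S (g \<otimes> h) \<le> word_length G S g + word_length G S h"
proof -
  have SG: "S \<subseteq> carrier G"
    using S unfolding finite_symmetric_generating_set_def by auto
  obtain ws where ws: "set ws \<subseteq> S" "length ws = word_length G S g" "foldr (\<otimes>) ws \<one> = g"
    using word_length_witness[OF S g] .
  obtain vs where vs: "set vs \<subseteq> S" "length vs = word_length G S h" "foldr (\<otimes>) vs \<one> = h"
    using word_length_witness[OF S h] .
  have "set (ws @ vs) \<subseteq> S \<and> length (ws @ vs) = word_length G S g + word_length G S h \<and>
      foldr (\<otimes>) (ws @ vs) \<one> = g \<otimes> h"
    using ws vs SG foldr_mult_append[of ws vs] by auto
  then show ?thesis
    unfolding word_length_def[of G S "g \<otimes> h"] by (intro Least_le) blast
qed

lemma word_length_one: "word_length G S \<one> = 0"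
  unfolding word_length_def by (rule Least_eq_0) simp

lemma finite_word_ball:
  assumes S: "finite_symmetric_generating_set G S"
  shows "finite (word_ball G S R)"
proof -
  have "finite {ws. set ws \<subseteq> S \<and> length ws \<le> nat \<lfloor>R\<rfloor>}"
    using S unfolding finite_symmetric_generating_set_def by (intro finite_lists_length_le) auto
  moreover have "word_ball G S R \<subseteq> (\<lambda>ws. foldr (\<otimes>) ws \<one>) ` {ws. set ws \<subseteq> S \<and> length ws \<le> nat \<lfloor>R\<rfloor>}"
  proof
    fix g assume "g \<in> word_ball G S R"
    then have g: "g \<in> carrier G" "word_length G S g \<le> nat \<lfloor>R\<rfloor>"
      unfolding word_ball_def by (auto simp: le_nat_floor)
    then show "g \<in> (\<lambda>ws. foldr (\<otimes>) ws \<one>) ` {ws. set ws \<subseteq> S \<and> length ws \<le> nat \<lfloor>R\<rfloor>}"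
      by (metis (mono_tags, lifting) word_length_witness[OF S g(1)] imageI mem_Collect_eq)
  qed
  ultimately show ?thesis
    by (meson finite_imageI finite_subset)
qed

end

section \<open>The mixed norm\<close>

lemma infsum_cmod_eq_sum:
  fixes f :: "'a \<Rightarrow> complex"
  assumes "finite A" "\<And>g. g \<in> X - A \<Longrightarrow> f g = 0"
  shows "(\<Sum>\<^sub>\<infinity>g\<in>X. cmod (f g)) = (\<Sum>g\<in>X \<inter> A. cmod (f g))"
proof -
  have "(\<Sum>\<^sub>\<infinity>g\<in>X. cmod (f g)) = (\<Sum>\<^sub>\<infinity>g\<in>X \<inter> A. cmod (f g))"
    using assms(2) by (intro infsum_cong_neutral) auto
  then show ?thesis
    using assms(1) by simp
qed

context group
begin

lemma lcosets_eq_l_coset: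
  assumes "subgroup H G" "X \<in> lcosets H" "g \<in> X"
  shows "X = g <# H"
  using assms l_repr_independence[of g _ H] unfolding LCOSETS_def by blast

lemma finite_lcosets_meeting:
  assumes "subgroup H G" "finite A"
  shows "finite {X \<in> lcosets H. X \<inter> A \<noteq> {}}"
proof (rule finite_subset)
  show "{X \<in> lcosets H. X \<inter> A \<noteq> {}} \<subseteq> (\<lambda>g. g <# H) ` A"
    using lcosets_eq_l_coset[OF assms(1)] by blast
qed (use assms in simp)

text \<open>\<open>A\<close> may exceed the support of \<open>f\<close>, and the finite family may
  contain cosets that miss \<open>A\<close>; both can thus be fitted to the situation.\<close>

lemma norm21_eq_sum:
  assumes H: "subgroup H G" and A: "finite A" and f: "\<And>g. g \<in> carrier G - A \<Longrightarrow> f g = 0"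
    and fin: "finite \<X>" "\<X> \<subseteq> lcosets H" and meet: "\<And>X. X \<in> lcosets H \<Longrightarrow> X \<inter> A \<noteq> {} \<Longrightarrow> X \<in> \<X>"
  shows "norm21 G H f = sqrt (\<Sum>X\<in>\<X>. (\<Sum>g\<in>X \<inter> A. cmod (f g))\<^sup>2)"
proof -
  have eq: "(\<Sum>\<^sub>\<infinity>g\<in>X. cmod (f g)) = (\<Sum>g\<in>X \<inter> A. cmod (f g))" if "X \<in> lcosets H" for X
    using A f subgroup.lcosets_carrier[OF H group_axioms that] by (intro infsum_cmod_eq_sum) auto
  have "(\<Sum>\<^sub>\<infinity>X\<in>lcosets H. (\<Sum>\<^sub>\<infinity>g\<in>X. cmod (f g))\<^sup>2) = (\<Sum>\<^sub>\<infinity>X\<in>\<X>. (\<Sum>g\<in>X \<inter> A. cmod (f g))\<^sup>2)"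
  proof (rule infsum_cong_neutral)
    fix X assume X: "X \<in> lcosets H - \<X>"
    then have "X \<inter> A = {}" using meet by blast
    then show "(\<Sum>\<^sub>\<infinity>g\<in>X. cmod (f g))\<^sup>2 = 0"
      using eq X by simp
  qed (use fin eq in auto)
  then show ?thesis
    using fin unfolding norm21_def by simp
qed

lemma norm21_single_coset:
  assumes H: "subgroup H G" and X: "X \<in> lcosets H" and A: "finite A" "A \<subseteq> X"
    and f: "\<And>g. g \<in> carrier G - A \<Longrightarrow> f g = 0"
  shows "norm21 G H f = (\<Sum>g\<in>A. cmod (f g))"
proof -
  have "norm21 G H f = sqrt (\<Sum>X\<in>{X}. (\<Sum>g\<in>X \<inter> A. cmod (f g))\<^sup>2)"
    using lcos_disjoint[OF H X] X A by (intro norm21_eq_sum[OF H A(1) f]) blast+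
  moreover have "X \<inter> A = A"
    using A by blast
  ultimately show ?thesis
    by (simp add: sum_nonneg)
qed

text \<open>On a coset \<open>X\<close> the inner sum is at most
  \<open>W * card (X \<inter> A)\<close>. After squaring, one factor
  \<open>card (X \<inter> A)\<close> is replaced by \<open>k\<close>, the other sums to
  \<open>card A\<close> by disjointness of cosets.\<close>

lemma norm21_le:
  assumes H: "subgroup H G" and A: "finite A" "A \<subseteq> carrier G"
    and f: "\<And>g. g \<in> carrier G - A \<Longrightarrow> f g = 0"
    and W: "\<And>g. g \<in> A \<Longrightarrow> cmod (f g) \<le> W"
    and k: "\<And>X. X \<in> lcosets H \<Longrightarrow> card (X \<inter> A) \<le> k"
  shows "(norm21 G H f)\<^sup>2 \<le> W\<^sup>2 * k * card A"
proof -
  define \<X> where "\<X> = {X \<in> lcosets H. X \<inter> A \<noteq> {}}"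
  have fin: "finite \<X>"
    unfolding \<X>_def by (rule finite_lcosets_meeting[OF H A(1)])
  have "(norm21 G H f)\<^sup>2 = (\<Sum>X\<in>\<X>. (\<Sum>g\<in>X \<inter> A. cmod (f g))\<^sup>2)"
    using fin by (subst norm21_eq_sum[OF H A(1) f, where \<X> = \<X>]) (auto simp: \<X>_def sum_nonneg)
  also have "\<dots> \<le> (\<Sum>X\<in>\<X>. W\<^sup>2 * k * card (X \<inter> A))"
  proof (rule sum_mono)
    fix X assume X: "X \<in> \<X>"
    have "(\<Sum>g\<in>X \<inter> A. cmod (f g)) \<le> card (X \<inter> A) * W"
      using W by (intro sum_bounded_above) auto
    then have "(\<Sum>g\<in>X \<inter> A. cmod (f g))\<^sup>2 \<le> (card (X \<inter> A) * W)\<^sup>2"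
      by (intro power_mono sum_nonneg) auto
    also have "\<dots> = W\<^sup>2 * card (X \<inter> A) * card (X \<inter> A)"
      by (simp add: power2_eq_square algebra_simps)
    also have "\<dots> \<le> W\<^sup>2 * k * card (X \<inter> A)"
      using k X unfolding \<X>_def by (intro mult_right_mono mult_left_mono) auto
    finally show "(\<Sum>g\<in>X \<inter> A. cmod (f g))\<^sup>2 \<le> W\<^sup>2 * k * card (X \<inter> A)" .
  qed
  also have "\<dots> = W\<^sup>2 * k * (\<Sum>X\<in>\<X>. card (X \<inter> A))"
    by (simp add: sum_distrib_left)
  also have "(\<Sum>X\<in>\<X>. card (X \<inter> A)) = card (\<Union>X\<in>\<X>. X \<inter> A)"
    using fin A lcos_disjoint[OF H] unfolding \<X>_def by (intro card_UN_disjoint[symmetric]) blast+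
  also have "(\<Union>X\<in>\<X>. X \<inter> A) = A"
    using lcosets_part_G[OF H] A unfolding \<X>_def by blast
  finally show ?thesis .
qed

section \<open>Boundedness of convolution in the mixed norm\<close>

lemma sum_coset_mass_le_norm21:
  assumes H: "subgroup H G" and \<psi>: "\<psi> \<in> group_algebra G" and fin: "finite \<X>" "\<X> \<subseteq> lcosets H"
  shows "(\<Sum>X\<in>\<X>. (\<Sum>\<^sub>\<infinity>g\<in>X. cmod (\<psi> g))\<^sup>2) \<le> (norm21 G H \<psi>)\<^sup>2"
proof -
  define A where "A = {g. \<psi> g \<noteq> 0}"
  have A: "finite A"
    using \<psi> unfolding A_def group_algebra_def by auto
  have eq: "(\<Sum>\<^sub>\<infinity>g\<in>X. cmod (\<psi> g)) = (\<Sum>g\<in>X \<inter> A. cmod (\<psi> g))" for X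
    using A by (intro infsum_cmod_eq_sum) (auto simp: A_def)
  define \<Y> where "\<Y> = \<X> \<union> {X \<in> lcosets H. X \<inter> A \<noteq> {}}"
  have \<Y>: "finite \<Y>"
    using finite_lcosets_meeting[OF H A] fin by (simp add: \<Y>_def)
  have "norm21 G H \<psi> = sqrt (\<Sum>X\<in>\<Y>. (\<Sum>g\<in>X \<inter> A. cmod (\<psi> g))\<^sup>2)"
    using fin \<Y> by (intro norm21_eq_sum[OF H A]) (auto simp: \<Y>_def A_def)
  then have "(norm21 G H \<psi>)\<^sup>2 = (\<Sum>X\<in>\<Y>. (\<Sum>\<^sub>\<infinity>g\<in>X. cmod (\<psi> g))\<^sup>2)"
    by (simp add: eq sum_nonneg)
  then show ?thesis
    using \<Y> by (auto simp: \<Y>_def intro!: sum_mono2)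
qed

lemma l_coset_translate:
  assumes H: "subgroup H G" and h: "h \<in> carrier G" and X: "X \<in> lcosets H"
  shows "(\<lambda>g. h \<otimes> g) ` X \<in> lcosets H"
proof -
  obtain x where x: "x \<in> carrier G" "X = x <# H"
    using X unfolding LCOSETS_def by blast
  have "(\<lambda>g. h \<otimes> g) ` X = (h \<otimes> x) <# H"
    using subgroup.subset[OF H] h x unfolding l_coset_def by (fastforce simp: m_assoc)
  then show ?thesis
    using h x unfolding LCOSETS_def by blast
qed

text \<open>Cauchy--Schwarz over the support of \<open>f\<close> replaces Minkowski's inequality; the constant is
  irrelevant, it only ensures that the supremum defining \<open>norm_h\<close> is a genuine one.\<close>

lemma norm21_convolution_le:
  assumes H: "subgroup H G" and f: "f \<in> group_algebra G" and \<psi>: "\<psi> \<in> group_algebra G"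
  defines "F \<equiv> {h \<in> carrier G. f h \<noteq> 0}"
  shows "(norm21 G H (convolution G f \<psi>))\<^sup>2 \<le> card F * (\<Sum>h\<in>F. (cmod (f h))\<^sup>2) * (norm21 G H \<psi>)\<^sup>2"
proof -
  define P where "P = {g. \<psi> g \<noteq> 0}"
  define m where "m X = (\<Sum>\<^sub>\<infinity>g\<in>X. cmod (\<psi> g))" for X
  define tr where "tr h X = (\<lambda>g. inv h \<otimes> g) ` X" for h X
  have F: "finite F" "F \<subseteq> carrier G"
    using f unfolding F_def group_algebra_def by (auto intro: finite_subset)
  have P: "finite P" "P \<subseteq> carrier G"
    using \<psi> unfolding P_def group_algebra_def by auto
  define A where "A = (\<lambda>(h, p). h \<otimes> p) ` (F \<times> P)"
  have A: "finite A" "A \<subseteq> carrier G"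
    using F P unfolding A_def by auto
  have in_A: "g \<in> A" if "g \<in> carrier G" "h \<in> F" "\<psi> (inv h \<otimes> g) \<noteq> 0" for g h
  proof -
    have "g = h \<otimes> (inv h \<otimes> g)"
      using that F by (simp flip: m_assoc add: subset_iff)
    then show ?thesis
      using that unfolding A_def P_def by (force simp: image_iff)
  qed
  have conv: "convolution G f \<psi> g = (\<Sum>h\<in>F. f h * \<psi> (inv h \<otimes> g))" if "g \<in> carrier G" for g
    using that unfolding convolution_def F_def by simp
  have conv_0: "convolution G f \<psi> g = 0" if "g \<in> carrier G - A" for g
    using that in_A by (auto simp: conv intro!: sum.neutral)
  define \<X> where "\<X> = {X \<in> lcosets H. X \<inter> A \<noteq> {}}"
  have \<X>: "finite \<X>" "\<X> \<subseteq> lcosets H"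
    using finite_lcosets_meeting[OF H A(1)] unfolding \<X>_def by auto
  have mass: "(\<Sum>g\<in>X \<inter> A. cmod (convolution G f \<psi> g)) \<le> (\<Sum>h\<in>F. cmod (f h) * m (tr h X))"
    if X: "X \<in> \<X>" for X
  proof -
    have XG: "X \<subseteq> carrier G"
      using X subgroup.lcosets_carrier[OF H group_axioms] unfolding \<X>_def by blast
    have "(\<Sum>g\<in>X \<inter> A. cmod (convolution G f \<psi> g)) \<le> (\<Sum>g\<in>X \<inter> A. \<Sum>h\<in>F. cmod (f h) * cmod (\<psi> (inv h \<otimes> g)))"
    proof (intro sum_mono)
      fix g assume "g \<in> X \<inter> A"
      then have "g \<in> carrier G" using A by blast
      then show "cmod (convolution G f \<psi> g) \<le> (\<Sum>h\<in>F. cmod (f h) * cmod (\<psi> (inv h \<otimes> g)))"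
        using norm_sum[of "\<lambda>h. f h * \<psi> (inv h \<otimes> g)" F] by (simp add: conv norm_mult)
    qed
    also have "\<dots> = (\<Sum>h\<in>F. cmod (f h) * (\<Sum>g\<in>X \<inter> A. cmod (\<psi> (inv h \<otimes> g))))"
      by (subst sum.swap) (simp add: sum_distrib_left)
    also have "\<dots> \<le> (\<Sum>h\<in>F. cmod (f h) * m (tr h X))"
    proof (intro sum_mono mult_left_mono)
      fix h assume h: "h \<in> F"
      \<comment> \<open>Translation by \<open>inv h\<close> carries \<open>X \<inter> A\<close>
        injectively into the coset \<open>tr h X\<close>, so the inner sum is at most the mass of
        \<psi> on that coset.\<close>
      have inj: "inj_on (\<lambda>g. inv h \<otimes> g) (X \<inter> A)"
        using h F XG by (auto intro!: inj_onI simp: subset_iff)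
      have "(\<Sum>g\<in>X \<inter> A. cmod (\<psi> (inv h \<otimes> g))) = (\<Sum>y\<in>(\<lambda>g. inv h \<otimes> g) ` (X \<inter> A). cmod (\<psi> y))"
        using inj by (simp add: sum.reindex)
      also have "\<dots> \<le> m (tr h X)"
        unfolding m_def
      proof (rule finite_sum_le_infsum)
        show "(\<lambda>y. cmod (\<psi> y)) summable_on tr h X"
          using P by (intro finite_nonzero_values_imp_summable_on) (auto simp: P_def intro: finite_subset)
      qed (use A in \<open>auto simp: tr_def\<close>)
      finally show "(\<Sum>g\<in>X \<inter> A. cmod (\<psi> (inv h \<otimes> g))) \<le> m (tr h X)" .
    qed auto
    finally show ?thesis .
  qed
  \<comment> \<open>\<open>tr h\<close> sends distinct cosets to distinct cosets, so for fixed
    \<open>h\<close> these masses form a partial sum of the squared norm of \<psi>.\<close>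
  have translate: "(\<Sum>X\<in>\<X>. (m (tr h X))\<^sup>2) \<le> (norm21 G H \<psi>)\<^sup>2" if h: "h \<in> F" for h
  proof -
    have hG: "inv h \<in> carrier G"
      using h F by auto
    have "inj_on (tr h) \<X>"
    proof (rule inj_on_subset)
      have "inj_on (\<lambda>g. inv h \<otimes> g) (carrier G)"
        using hG by (auto intro!: inj_onI)
      then show "inj_on (tr h) (Pow (carrier G))"
        unfolding tr_def by (rule inj_on_image_Pow)
      show "\<X> \<subseteq> Pow (carrier G)"
        using \<X> lcosets_subset_PowG[OF H] by blast
    qed
    then have "(\<Sum>X\<in>\<X>. (m (tr h X))\<^sup>2) = (\<Sum>Y\<in>tr h ` \<X>. (m Y)\<^sup>2)"
      by (simp add: sum.reindex)
    also have "\<dots> \<le> (norm21 G H \<psi>)\<^sup>2"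
      unfolding m_def using \<X> l_coset_translate[OF H hG]
      by (intro sum_coset_mass_le_norm21[OF H \<psi>]) (auto simp: tr_def)
    finally show ?thesis .
  qed
  have "(norm21 G H (convolution G f \<psi>))\<^sup>2 = (\<Sum>X\<in>\<X>. (\<Sum>g\<in>X \<inter> A. cmod (convolution G f \<psi> g))\<^sup>2)"
    using \<X> by (subst norm21_eq_sum[OF H A(1) conv_0, where \<X> = \<X>]) (auto simp: \<X>_def sum_nonneg)
  also have "\<dots> \<le> (\<Sum>X\<in>\<X>. (\<Sum>h\<in>F. cmod (f h) * m (tr h X))\<^sup>2)"
    using mass by (intro sum_mono power_mono sum_nonneg) auto
  also have "\<dots> \<le> (\<Sum>X\<in>\<X>. card F * (\<Sum>h\<in>F. (cmod (f h) * m (tr h X))\<^sup>2))"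
    by (intro sum_mono) (metis sum_squared_le_sum_of_squares mult.commute)
  also have "\<dots> = card F * (\<Sum>h\<in>F. (cmod (f h))\<^sup>2 * (\<Sum>X\<in>\<X>. (m (tr h X))\<^sup>2))"
    unfolding sum_distrib_left[symmetric] by (subst sum.swap) (simp add: power_mult_distrib sum_distrib_left)
  also have "\<dots> \<le> card F * (\<Sum>h\<in>F. (cmod (f h))\<^sup>2 * (norm21 G H \<psi>)\<^sup>2)"
    using translate by (intro mult_left_mono sum_mono) auto
  finally show ?thesis
    by (simp add: sum_distrib_right mult.assoc)
qed

section \<open>Testing \<open>norm_h\<close> on translates of finite subsets of
  \<open>H\<close>\<close>

lemma norm21_convolution_le_norm_h:
  assumes H: "subgroup H G" and f: "f \<in> group_algebra G"
    and \<psi>: "\<psi> \<in> group_algebra G" "norm21 G H \<psi> = 1"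
  shows "norm21 G H (convolution G f \<psi>) \<le> norm_h G H f"
  unfolding norm_h_def
proof (rule cSup_upper)
  let ?c = "card {h \<in> carrier G. f h \<noteq> 0} * (\<Sum>h\<in>{h \<in> carrier G. f h \<noteq> 0}. (cmod (f h))\<^sup>2)"
  \<comment> \<open>A real supremum dominates its set only if the set is bounded above. The bound
    \<open>sqrt ?c\<close> depends on \<open>f\<close> alone, since \<psi> is normalized.\<close>
  show "bdd_above {norm21 G H (convolution G f \<psi>) |\<psi>. \<psi> \<in> group_algebra G \<and> norm21 G H \<psi> = 1}"
  proof (rule bdd_aboveI[where M = "sqrt ?c"])
    fix x assume "x \<in> {norm21 G H (convolution G f \<psi>) |\<psi>. \<psi> \<in> group_algebra G \<and> norm21 G H \<psi> = 1}"
    then obtain \<psi> where "x = norm21 G H (convolution G f \<psi>)" "\<psi> \<in> group_algebra G" "norm21 G H \<psi> = 1"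
      by blast
    then show "x \<le> sqrt ?c"
      using norm21_convolution_le[OF H f, of \<psi>] by (auto intro: real_le_rsqrt)
  qed
qed (use \<psi> in blast)

text \<open>Convolving the indicator of \<open>Bt\<close> with the point mass at \<open>t\<^sup>-\<^sup>1\<close> gives the indicator of
  \<open>B \<subseteq> H\<close>, which has norm \<open>|B|\<close>.\<close>

lemma card_le_norm_h:
  assumes H: "subgroup H G" and B: "finite B" "B \<subseteq> H" and t: "t \<in> carrier G"
  shows "card B \<le> norm_h G H (indicator ((\<lambda>b. b \<otimes> t) ` B))"
proof -
  define f :: "'a \<Rightarrow> complex" where "f = indicator ((\<lambda>b. b \<otimes> t) ` B)"
  define \<psi> :: "'a \<Rightarrow> complex" where "\<psi> = indicator {inv t}"
  have HG: "H \<subseteq> carrier G"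
    by (rule subgroup.subset[OF H])
  have f: "f \<in> group_algebra G"
    using B HG t unfolding f_def group_algebra_def by (auto simp: indicator_def)
  have \<psi>: "\<psi> \<in> group_algebra G"
    using t unfolding \<psi>_def group_algebra_def by (auto simp: indicator_def)
  have "inv t <# H \<in> lcosets H" "inv t \<in> inv t <# H"
    using t lcos_self[OF _ H] unfolding LCOSETS_def by auto
  then have "norm21 G H \<psi> = (\<Sum>g\<in>{inv t}. cmod (\<psi> g))"
    by (intro norm21_single_coset[OF H]) (auto simp: \<psi>_def)
  then have \<psi>1: "norm21 G H \<psi> = 1"
    by (simp add: \<psi>_def)
  have conv: "convolution G f \<psi> g = indicator B g" if g: "g \<in> carrier G" for g
  proof -
    have supp: "{h \<in> carrier G. f h \<noteq> 0} = (\<lambda>b. b \<otimes> t) ` B"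
      using B HG t by (auto simp: f_def indicator_def)
    \<comment> \<open>Only the term \<open>h = g \<otimes> t\<close> of the convolution survives,
      and it occurs exactly when \<open>g\<close> lies in \<open>B\<close>.\<close>
    have \<psi>_eq: "\<psi> (inv h \<otimes> g) = (if h = g \<otimes> t then 1 else 0)" if h: "h \<in> carrier G" for h
    proof -
      have "inv h \<otimes> g = inv t \<longleftrightarrow> h = g \<otimes> t"
        using g h t by (metis inv_closed inv_equality inv_inv inv_solve_left m_assoc m_closed r_inv l_inv)
      then show ?thesis
        unfolding \<psi>_def indicator_def by simp
    qed
    have "convolution G f \<psi> g = (\<Sum>h\<in>(\<lambda>b. b \<otimes> t) ` B. f h * \<psi> (inv h \<otimes> g))"
      using g by (simp add: convolution_def supp)
    also have "\<dots> = (\<Sum>h\<in>(\<lambda>b. b \<otimes> t) ` B. if h = g \<otimes> t then 1 else 0)"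
    proof (rule sum.cong)
      fix h assume h: "h \<in> (\<lambda>b. b \<otimes> t) ` B"
      then have "h \<in> carrier G" using B HG t by auto
      with h show "f h * \<psi> (inv h \<otimes> g) = (if h = g \<otimes> t then 1 else 0)"
        using \<psi>_eq by (simp add: f_def)
    qed simp
    also have "\<dots> = (if g \<otimes> t \<in> (\<lambda>b. b \<otimes> t) ` B then 1 else 0)"
      using B by (simp add: sum.delta)
    also have "g \<otimes> t \<in> (\<lambda>b. b \<otimes> t) ` B \<longleftrightarrow> g \<in> B"
      using B HG t g by (auto simp: subset_iff)
    finally show ?thesis
      by (simp add: indicator_def)
  qed
  have "\<one> <# H = H"
    using HG by (rule lcos_mult_one)
  then have "H \<in> lcosets H"
    unfolding LCOSETS_def by force
  then have "norm21 G H (convolution G f \<psi>) = (\<Sum>g\<in>B. cmod (convolution G f \<psi> g))"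
    using B conv by (intro norm21_single_coset[OF H]) auto
  also have "\<dots> = card B"
    using B HG conv by (simp add: subset_iff)
  finally show ?thesis
    using norm21_convolution_le_norm_h[OF H f \<psi> \<psi>1] by (simp add: f_def)
qed

text \<open>If \<open>b \<otimes> t\<close> and \<open>b0 \<otimes> t\<close> share a left coset of
  \<open>H\<close>, then \<open>inv b0 \<otimes> b\<close> lies in \<open>H\<close> and in its
  conjugate by \<open>t\<close>. Fixing \<open>b0\<close> injects the points of the coset into that
  intersection.\<close>

lemma card_coset_inter_translate_le:
  assumes H: "subgroup H G" and B: "B \<subseteq> H" and t: "t \<in> carrier G"
    and fin: "finite (H \<inter> (\<lambda>h. t \<otimes> h \<otimes> inv t) ` H)" and X: "X \<in> lcosets H"
  shows "card (X \<inter> (\<lambda>b. b \<otimes> t) ` B) \<le> card (H \<inter> (\<lambda>h. t \<otimes> h \<otimes> inv t) ` H)"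
proof (cases "X \<inter> (\<lambda>b. b \<otimes> t) ` B = {}")
  case False
  then obtain b0 where b0: "b0 \<in> B" "b0 \<otimes> t \<in> X"
    by blast
  have HG: "H \<subseteq> carrier G"
    by (rule subgroup.subset[OF H])
  have XG: "X \<subseteq> carrier G"
    using subgroup.lcosets_carrier[OF H group_axioms X] .
  have b0G: "b0 \<in> carrier G"
    using b0 B HG by auto
  have X_eq: "X = (b0 \<otimes> t) <# H"
    using lcosets_eq_l_coset[OF H X b0(2)] .
  let ?f = "\<lambda>y. inv b0 \<otimes> (y \<otimes> inv t)"
  show ?thesis
  proof (rule card_inj_on_le[OF _ _ fin])
    show "inj_on ?f (X \<inter> (\<lambda>b. b \<otimes> t) ` B)"
      using XG t b0G by (auto intro!: inj_onI simp: subset_iff)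
    show "?f ` (X \<inter> (\<lambda>b. b \<otimes> t) ` B) \<subseteq> H \<inter> (\<lambda>h. t \<otimes> h \<otimes> inv t) ` H"
    proof safe
      fix b assume b: "b \<in> B" "b \<otimes> t \<in> X"
      then have bG: "b \<in> carrier G"
        using B HG by auto
      have "?f (b \<otimes> t) = inv b0 \<otimes> b"
        using t bG b0G by (simp add: m_assoc)
      then show "?f (b \<otimes> t) \<in> H"
        using b b0 B H by (auto intro: subgroup.m_closed subgroup.m_inv_closed)
      obtain h where h: "h \<in> H" "b \<otimes> t = b0 \<otimes> t \<otimes> h"
        using b(2) unfolding X_eq l_coset_def by blast
      then have "?f (b \<otimes> t) = t \<otimes> h \<otimes> inv t"
        using t b0G HG by (simp add: subset_iff flip: m_assoc)
      then show "?f (b \<otimes> t) \<in> (\<lambda>h. t \<otimes> h \<otimes> inv t) ` H"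
        using h(1) by blast
    qed
  qed
qed simp

text \<open>The norm of the indicator of \<open>Bt\<close> is only of order \<open>|B|\<^sup>1\<^sup>/\<^sup>2\<close>: each left coset of \<open>H\<close>
  contains at most \<open>|H \<inter> tHt\<^sup>-\<^sup>1|\<close> of its points.\<close>

lemma card_le_of_weight_bound:
  assumes H: "subgroup H G" and B: "finite B" "B \<subseteq> H" and t: "t \<in> carrier G"
    and fin: "finite (H \<inter> (\<lambda>h. t \<otimes> h \<otimes> inv t) ` H)"
    and C: "C > 0" "\<And>f. f \<in> group_algebra G \<Longrightarrow> 
              norm_h G H f \<le> C * norm21 G H (\<lambda>g. f g * complex_of_real (w g))"
    and w: "\<And>b. b \<in> B \<Longrightarrow> 0 \<le> w (b \<otimes> t) \<and> w (b \<otimes> t) \<le> W"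
  shows "real (card B) \<le> C\<^sup>2 * card (H \<inter> (\<lambda>h. t \<otimes> h \<otimes> inv t) ` H) * W\<^sup>2"
proof (cases "B = {}")
  case False
  define A where "A = (\<lambda>b. b \<otimes> t) ` B"
  define k where "k = card (H \<inter> (\<lambda>h. t \<otimes> h \<otimes> inv t) ` H)"
  define f :: "'a \<Rightarrow> complex" where "f = indicator A"
  have HG: "H \<subseteq> carrier G"
    by (rule subgroup.subset[OF H])
  have A: "finite A" "A \<subseteq> carrier G" "card A = card B"
  proof -
    show "card A = card B"
      unfolding A_def using B HG t by (intro card_image) (auto intro!: inj_onI simp: subset_iff)
  qed (use B HG t in \<open>auto simp: A_def\<close>)
  have f: "f \<in> group_algebra G"
    using A unfolding f_def group_algebra_def by (auto simp: indicator_def)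
  let ?n = "norm21 G H (\<lambda>g. f g * complex_of_real (w g))"
  have "?n\<^sup>2 \<le> W\<^sup>2 * k * card A"
  proof (rule norm21_le[OF H A(1,2)])
    show "card (X \<inter> A) \<le> k" if "X \<in> lcosets H" for X
      using card_coset_inter_translate_le[OF H B(2) t fin that] by (simp add: A_def k_def)
    show "cmod (f g * complex_of_real (w g)) \<le> W" if "g \<in> A" for g
      using w that by (auto simp: f_def A_def norm_mult)
  qed (simp add: f_def)
  have "real (card B) \<le> C * ?n"
    using card_le_norm_h[OF H B t] C(2)[OF f] by (simp add: f_def A_def)
  then have "(real (card B))\<^sup>2 \<le> (C * ?n)\<^sup>2"
    by (intro power_mono) auto
  also have "\<dots> \<le> C\<^sup>2 * (W\<^sup>2 * k * card B)"
    using \<open>?n\<^sup>2 \<le> _\<close> A(3) by (simp add: power_mult_distrib mult_left_mono)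
  finally have "real (card B) * real (card B) \<le> (C\<^sup>2 * k * W\<^sup>2) * real (card B)"
    by (simp add: power2_eq_square algebra_simps)
  moreover have "real (card B) > 0"
    using False B by (simp add: card_gt_0_iff)
  ultimately show ?thesis
    unfolding k_def by (simp add: mult_le_cancel_right)
qed simp

section \<open>From the norm inequality to relative growth\<close>

lemma SLC_subexp_imp_subexponential_growth:
  assumes S: "finite_symmetric_generating_set G S" and H: "subgroup H G" and t: "t \<in> carrier G"
    and fin: "finite (H \<inter> (\<lambda>h. t \<otimes> h \<otimes> inv t) ` H)" and SLC: "SLC_subexp G S H"
  shows "relative_growth G S H \<le> 1"
proof (rule ccontr)
  assume "\<not> relative_growth G S H \<le> 1"
  then obtain c :: real where c: "1 < c" "ereal c < relative_growth G S H"
    using ereal_dense2[of 1 "relative_growth G S H"] by (auto simp: one_ereal_def not_le)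
  obtain C w where C: "C > 0" "\<And>f. f \<in> group_algebra G \<Longrightarrow> 
              norm_h G H f \<le> C * norm21 G H (\<lambda>g. f g * complex_of_real (w g))"
    and w: "\<And>g. g \<in> carrier G \<Longrightarrow> w g \<ge> 1"
    and lim: "((\<lambda>t::real. ln (Sup (w ` word_ball G S t)) / t) \<longlongrightarrow> 0) at_top"
    using SLC unfolding SLC_subexp_def by blast
  define W where "W R = Sup (w ` word_ball G S R)" for R
  define k where "k = card (H \<inter> (\<lambda>h. t \<otimes> h \<otimes> inv t) ` H)"
  define L where "L = real (word_length G S t)"
  have HG: "H \<subseteq> carrier G"
    by (rule subgroup.subset[OF H])
  have w_le: "w g \<le> W R" if "g \<in> word_ball G S R" for g R
    unfolding W_def using that finite_word_ball[OF S] by (intro cSup_upper bdd_above_finite) auto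
  have one_ball: "\<one> \<in> word_ball G S R" if "R \<ge> 0" for R
    using that by (simp add: word_ball_def word_length_one)
  have W_ge: "W R \<ge> 1" if "R \<ge> 0" for R
    using w_le[OF one_ball[OF that]] w[of \<one>] by simp
  have one_in: "\<one> \<in> H \<inter> (\<lambda>h. t \<otimes> h \<otimes> inv t) ` H"
    using subgroup.one_closed[OF H] t by (auto intro!: image_eqI[of _ _ \<one>])
  then have k: "k \<ge> 1"
    unfolding k_def using fin by (metis One_nat_def Suc_leI card_gt_0_iff empty_iff)
  define a where "a R = real (card (H \<inter> word_ball G S R))" for R
  \<comment> \<open>Right translation by \<open>t\<close> lengthens words by at most
    \<open>L\<close>, hence the larger radius in the weight bound.\<close>
  have a_le: "a R \<le> C\<^sup>2 * k * (W (R + L))\<^sup>2" for R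
    unfolding a_def k_def
  proof (rule card_le_of_weight_bound[OF H _ _ t fin C])
    fix b assume b: "b \<in> H \<inter> word_ball G S R"
    then have "b \<otimes> t \<in> word_ball G S (R + L)"
      using word_length_mult_le[OF S _ t, of b] t unfolding word_ball_def L_def by fastforce
    then show "0 \<le> w (b \<otimes> t) \<and> w (b \<otimes> t) \<le> W (R + L)"
      using w[of "b \<otimes> t"] w_le unfolding word_ball_def by fastforce
  qed (use finite_word_ball[OF S] in auto)
  have a_ge: "a R \<ge> 1" if "R \<ge> 0" for R
  proof -
    have "\<one> \<in> H \<inter> word_ball G S R"
      using one_ball that subgroup.one_closed[OF H] by auto
    then have "card (H \<inter> word_ball G S R) > 0"
      using finite_word_ball[OF S] by (auto simp: card_gt_0_iff)
    then show ?thesis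
      by (simp add: a_def)
  qed
  define K where "K = ln (C\<^sup>2 * k)"
  have lnc: "ln c > 0"
    using c by simp
  \<comment> \<open>For \<open>R > L\<close> one has \<open>R + L \<le> 2 * R\<close>. With the
    factor 2 from the squared weight, \<open>ln c / 8\<close> uses up half of
    \<open>ln c * R\<close>; \<open>R > 2 * K / ln c\<close> leaves the other half for the constant
    \<open>K\<close>.\<close>
  have "\<forall>\<^sub>F T in at_top. ln (W T) / T < ln c / 8"
    using order_tendstoD(2)[OF lim, of "ln c / 8"] lnc by (simp add: W_def)
  moreover have "filterlim (\<lambda>R. R + L) at_top at_top"
    using filterlim_tendsto_add_at_top[OF tendsto_const[of L] filterlim_ident] by (simp add: add.commute)
  ultimately have "\<forall>\<^sub>F R in at_top. ln (W (R + L)) / (R + L) < ln c / 8"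
    by (rule eventually_compose_filterlim)
  moreover have "\<forall>\<^sub>F R in at_top. R > max 1 (max L (2 * K / ln c))"
    by (rule eventually_gt_at_top)
  ultimately have "\<forall>\<^sub>F R in at_top. ereal (a R powr (1 / R)) \<le> ereal c"
  proof eventually_elim
    case (elim R)
    then have R: "R > 1" "R > L" "R > 2 * K / ln c"
      by auto
    have L: "L \<ge> 0" by (simp add: L_def)
    have "ln (W (R + L)) < ln c / 8 * (R + L)"
      using elim R L by (simp add: divide_less_eq)
    also have "\<dots> \<le> ln c / 8 * (2 * R)"
      using R lnc by (intro mult_left_mono) auto
    finally have 1: "2 * ln (W (R + L)) \<le> ln c * R / 2"
      by (simp add: mult.commute)
    have 2: "K \<le> ln c * R / 2"
      using R(3) lnc by (simp add: divide_less_eq mult.commute)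
    have "ln (a R) \<le> ln (C\<^sup>2 * k * (W (R + L))\<^sup>2)"
      using a_le[of R] a_ge[of R] R by (intro ln_mono) auto
    also have "\<dots> = K + 2 * ln (W (R + L))"
      using C k W_ge[of "R + L"] R L by (simp add: K_def ln_mult ln_realpow)
    finally have "ln (a R) \<le> ln c * R"
      using 1 2 by simp
    then have "ln (a R) / R \<le> ln c"
      using R by (simp add: divide_le_eq)
    then have "exp (ln (a R) / R) \<le> exp (ln c)"
      by simp
    then show ?case
      using a_ge[of R] R c by (simp add: powr_def)
  qed
  then have "relative_growth G S H \<le> ereal c"
    unfolding relative_growth_def a_def by (rule Limsup_bounded)
  with c show False by simp
qed

end

section \<open>Gromov products\<close>

lemma gromov_product_commute: "gromov_product b x y = gromov_product b y x"
  by (simp add: gromov_product_def dist_commute)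

lemma gromov_product_base: "gromov_product c x y - dist b c \<le> gromov_product b x y"
  using dist_triangle[of c x b] dist_triangle[of c y b]
  by (simp add: gromov_product_def dist_commute field_simps)

lemma gromov_product_lipschitz: "gromov_product b y z - dist x y \<le> gromov_product b x z"
  using dist_triangle[of b y x] dist_triangle[of x z y]
  by (simp add: gromov_product_def dist_commute field_simps)

lemma gromov_product_le_dist: "gromov_product b x y \<le> dist b x"
  using dist_triangle[of b y x] by (simp add: gromov_product_def field_simps)

lemma gromov_product_swap: "gromov_product b a c + gromov_product a b c = dist a b"
  by (simp add: gromov_product_def dist_commute field_simps)

text \<open>Changing the base point alters Gromov products by a bounded amount, so a single one
  decides.\<close>

lemma converge_together_iff:
  fixes b :: "'x::metric_space"
  shows "converge_together u v \<longleftrightarrow> (\<forall>r. \<exists>N. \<forall>i\<ge>N. \<forall>j\<ge>N. gromov_product b (u i) (v j) \<ge> r)"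
    (is "_ \<longleftrightarrow> ?R")
proof
  assume "converge_together u v"
  then show ?R
    unfolding converge_together_def filterlim_at_top eventually_prod_sequentially split by blast
next
  assume R: ?R
  show "converge_together u v"
    unfolding converge_together_def filterlim_at_top eventually_prod_sequentially split
  proof (intro allI)
    fix c r
    obtain N where "\<forall>i\<ge>N. \<forall>j\<ge>N. gromov_product b (u i) (v j) \<ge> r + dist c b"
      using R by blast
    moreover have "gromov_product b x y - dist c b \<le> gromov_product c x y" for x y
      by (rule gromov_product_base)
    ultimately have "\<forall>m\<ge>N. \<forall>n\<ge>N. r \<le> gromov_product c (u n) (v m)"
      by (smt (verit))
    then show "\<exists>N. \<forall>m\<ge>N. \<forall>n\<ge>N. r \<le> gromov_product c (u n) (v m)" ..
  qed
qed

lemma converge_together_sym: "converge_together u v \<Longrightarrow> converge_together v u"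
  unfolding converge_together_iff[of _ _ undefined] by (metis gromov_product_commute)

locale hyperbolic_metric =
  fixes \<delta> :: real and base :: "'x::metric_space"
  assumes hyperbolic:
    "min (gromov_product b x y) (gromov_product b y z) - \<delta> \<le> gromov_product b x (z::'x)"
begin

lemma delta_nonneg: "\<delta> \<ge> 0"
  using hyperbolic[of base base base base] by (simp add: gromov_product_def)

lemma converge_together_trans:
  fixes u v w :: "nat \<Rightarrow> 'x"
  assumes "converge_together u v" "converge_together v w"
  shows "converge_together u w"
  unfolding converge_together_iff[of _ _ base]
proof
  fix r
  obtain N M where N: "\<forall>i\<ge>N. \<forall>j\<ge>N. gromov_product base (u i) (v j) \<ge> r + \<delta>"
    and M: "\<forall>i\<ge>M. \<forall>j\<ge>M. gromov_product base (v i) (w j) \<ge> r + \<delta>"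
    using assms unfolding converge_together_iff[of _ _ base] by meson
  have "gromov_product base (u i) (w j) \<ge> r" if "i \<ge> max N M" "j \<ge> max N M" for i j
    using that N M hyperbolic[of base "u i" "v (max N M)" "w j"]
    by (smt (verit) max.cobounded1 max.cobounded2 max.boundedE)
  then show "\<exists>N. \<forall>i\<ge>N. \<forall>j\<ge>N. r \<le> gromov_product base (u i) (w j)"
    by blast
qed

lemma gromov_boundaryE:
  fixes \<xi> :: "(nat \<Rightarrow> 'x) set"
  assumes "\<xi> \<in> gromov_boundary"
  obtains u where "u \<in> gromov_sequences" "\<xi> = {v \<in> gromov_sequences. converge_together u v}"
  using assms unfolding gromov_boundary_def quotient_def by fastforce

lemma gromov_boundary_member_iff:
  fixes \<xi> :: "(nat \<Rightarrow> 'x) set"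
  assumes "\<xi> \<in> gromov_boundary" "u \<in> \<xi>"
  shows "v \<in> \<xi> \<longleftrightarrow> v \<in> gromov_sequences \<and> converge_together u v"
  using assms by (elim gromov_boundaryE)
    (auto intro: converge_together_trans converge_together_sym)

lemma gromov_boundary_nonempty:
  fixes \<xi> :: "(nat \<Rightarrow> 'x) set"
  assumes "\<xi> \<in> gromov_boundary"
  obtains u where "u \<in> \<xi>"
  using assms by (elim gromov_boundaryE) (auto simp: gromov_sequences_def)

lemma gromov_boundary_eqI:
  fixes \<xi> \<eta> :: "(nat \<Rightarrow> 'x) set"
  assumes "\<xi> \<in> gromov_boundary" "\<eta> \<in> gromov_boundary" "u \<in> \<xi>" "v \<in> \<eta>" "converge_together u v"
  shows "\<xi> = \<eta>"
  using gromov_boundary_member_iff[OF assms(1,3)] gromov_boundary_member_iff[OF assms(2,4)] assms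
  by (blast intro: converge_together_trans converge_together_sym)

text \<open>Passing through \<open>y\<close>, which may depend on \<open>r\<close>, costs one
  \<delta>. In contrapositive form: for sequences that do not converge together there is a level at
  which no point is close to both.\<close>

lemma converge_together_if_common_points:
  fixes u v :: "nat \<Rightarrow> 'x"
  assumes "\<And>r. \<exists>y. (\<forall>\<^sub>F i in sequentially. r \<le> gromov_product base y (u i)) \<and>
                  (\<forall>\<^sub>F i in sequentially. r \<le> gromov_product base y (v i))"
  shows "converge_together u v"
  unfolding converge_together_iff[of _ _ base]
proof
  fix r
  obtain y N M where N: "\<And>i. i \<ge> N \<Longrightarrow> r + \<delta> \<le> gromov_product base y (u i)"
    and M: "\<And>i. i \<ge> M \<Longrightarrow> r + \<delta> \<le> gromov_product base y (v i)"
    using assms[of "r + \<delta>"] unfolding eventually_sequentially by blast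
  have "r \<le> gromov_product base (u i) (v j)" if "i \<ge> max N M" "j \<ge> max N M" for i j
    using that N[of i] M[of j] hyperbolic[of base "u i" y "v j"] gromov_product_commute[of base y "u i"]
    by auto
  then show "\<exists>N. \<forall>i\<ge>N. \<forall>j\<ge>N. r \<le> gromov_product base (u i) (v j)"
    by blast
qed

text \<open>Each \<open>y n\<close> is compared only with a tail of \<open>u\<close> depending on
  \<open>n\<close>. As \<open>u\<close> itself converges, a term of \<open>u\<close> far enough out
  links \<open>u i\<close> with \<open>y j\<close>.\<close>

lemma converge_together_if_approached:
  fixes u y :: "nat \<Rightarrow> 'x"
  assumes u: "u \<in> gromov_sequences"
    and y: "\<And>n. \<forall>\<^sub>F i in sequentially. real n \<le> gromov_product base (y n) (u i)"
  shows "y \<in> gromov_sequences" "converge_together u y"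
proof -
  show uy: "converge_together u y"
    unfolding converge_together_iff[of _ _ base]
  proof
    fix r
    obtain N where N: "\<And>i j. i \<ge> N \<Longrightarrow> j \<ge> N \<Longrightarrow> r + \<delta> \<le> gromov_product base (u i) (u j)"
      using u unfolding gromov_sequences_def converge_together_iff[of _ _ base] by blast
    obtain M :: nat where M: "r + \<delta> \<le> real M"
      using real_arch_simple by blast
    have "r \<le> gromov_product base (u i) (y j)" if "i \<ge> max N M" "j \<ge> max N M" for i j
    proof -
      obtain k0 where k0: "\<And>k. k \<ge> k0 \<Longrightarrow> real j \<le> gromov_product base (y j) (u k)"
        using y[of j] unfolding eventually_sequentially by blast
      let ?k = "max N k0"
      have "r + \<delta> \<le> gromov_product base (u i) (u ?k)"
        using N that by simp
      moreover have "r + \<delta> \<le> gromov_product base (u ?k) (y j)"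
        using k0[of ?k] M that gromov_product_commute[of base "y j"] by simp
      ultimately show ?thesis
        using hyperbolic[of base "u i" "u ?k" "y j"] by linarith
    qed
    then show "\<exists>N. \<forall>i\<ge>N. \<forall>j\<ge>N. r \<le> gromov_product base (u i) (y j)"
      by blast
  qed
  show "y \<in> gromov_sequences"
    unfolding gromov_sequences_def using converge_together_trans[OF converge_together_sym[OF uy] uy] by simp
qed

end

section \<open>Proper actions on hyperbolic spaces\<close>

text \<open>\<open>finite_displacement\<close> is proper discontinuity in its applied form: an
  infinite set of group elements moves \<open>base\<close> arbitrarily far.\<close>

locale hyperbolic_action = group G + hyperbolic_metric \<delta> base
  for G :: "('g, 'm) monoid_scheme" (structure) and \<delta> :: real and base :: "'x::metric_space" +
  fixes \<phi> :: "'g \<Rightarrow> 'x \<Rightarrow> 'x"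
  assumes dist_action: "g \<in> carrier G \<Longrightarrow> dist (\<phi> g x) (\<phi> g y) = dist x y"
    and action_mult: "g \<in> carrier G \<Longrightarrow> h \<in> carrier G \<Longrightarrow> \<phi> (g \<otimes> h) x = \<phi> g (\<phi> h x)"
    and action_one: "\<phi> \<one> x = x"
    and finite_displacement: "finite {g \<in> carrier G. dist base (\<phi> g base) \<le> r}"
begin

lemma gromov_product_action:
  "g \<in> carrier G \<Longrightarrow> gromov_product (\<phi> g b) (\<phi> g x) (\<phi> g y) = gromov_product b x y"
  by (simp add: gromov_product_def dist_action)

lemma action_inv: "g \<in> carrier G \<Longrightarrow> \<phi> g (\<phi> (inv g) x) = x"
  by (simp flip: action_mult add: action_one)

lemma gromov_product_inv:
  assumes "g \<in> carrier G"
  shows "gromov_product base (\<phi> (inv g) base) y = gromov_product (\<phi> g base) base (\<phi> g y)"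
  using gromov_product_action[OF assms, of base "\<phi> (inv g) base" y] assms by (simp add: action_inv)

lemma infinite_displacement:
  assumes "infinite A" "A \<subseteq> carrier G"
  obtains g where "g \<in> A" "r < dist base (\<phi> g base)"
proof -
  have "\<not> A \<subseteq> {g \<in> carrier G. dist base (\<phi> g base) \<le> r}"
    using assms finite_subset[OF _ finite_displacement] by blast
  then show ?thesis
    using that assms by force
qed

text \<open>The orbit of \<open>base\<close> accumulates at the limit of \<open>u\<close>. One orbit
  point per level \<open>r\<close> replaces a sequence, and \<open>u\<close> itself may lie off the
  orbit.\<close>

definition orbit_limit :: "(nat \<Rightarrow> 'x) \<Rightarrow> bool" where
  "orbit_limit u \<longleftrightarrow> u \<in> gromov_sequences \<and>
     (\<forall>r. \<exists>g\<in>carrier G. \<forall>\<^sub>F i in sequentially. r \<le> gromov_product base (\<phi> g base) (u i))"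

text \<open>If \<open>q\<close> fixes \<open>\<xi> = lim u\<close>, then \<open>(q b | \<xi>)\<close> and \<open>(q\<^sup>-\<^sup>1 b | \<xi>)\<close> add up to the displacement
  of \<open>q\<close>, up to a constant.\<close>

lemma fixed_point_dichotomy:
  assumes q: "q \<in> carrier G" and fixed: "converge_together u (\<phi> q \<circ> u)"
    and large: "2 * r + \<delta> < dist base (\<phi> q base)"
  shows "(\<forall>\<^sub>F i in sequentially. r \<le> gromov_product base (\<phi> q base) (u i)) \<or>
         (\<forall>\<^sub>F i in sequentially. r \<le> gromov_product base (\<phi> (inv q) base) (u i))"
proof (rule disjCI)
  assume not_ev: "\<not> (\<forall>\<^sub>F i in sequentially. r \<le> gromov_product base (\<phi> (inv q) base) (u i))"
  obtain N where N: "\<And>i j. i \<ge> N \<Longrightarrow> j \<ge> N \<Longrightarrow> r + \<delta> \<le> gromov_product base (u i) (\<phi> q (u j))"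
    using fixed unfolding converge_together_iff[of _ _ base] o_def by blast
  obtain j where j: "j \<ge> N" "gromov_product base (\<phi> (inv q) base) (u j) < r"
    using not_ev unfolding eventually_sequentially by (meson not_le)
  \<comment> \<open>The products based at \<open>base\<close> and at \<open>\<phi> q base\<close>
    add up to the displacement. The latter equals the product of \<open>\<phi> (inv q) base\<close>
    with \<open>u j\<close>, which is below \<open>r\<close>, so the former exceeds
    \<open>r + \<delta>\<close>.\<close>
  then have "gromov_product base (\<phi> q base) (\<phi> q (u j)) > r + \<delta>"
    using gromov_product_swap[of base "\<phi> q base" "\<phi> q (u j)"] large gromov_product_inv[OF q, of "u j"]
    by (simp add: dist_commute)
  then have "r \<le> gromov_product base (\<phi> q base) (u i)" if "i \<ge> N" for i
    using N[OF that \<open>j \<ge> N\<close>] hyperbolic[of base "\<phi> q base" "\<phi> q (u j)" "u i"]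
      gromov_product_commute[of base "u i"] by simp
  then show "\<forall>\<^sub>F i in sequentially. r \<le> gromov_product base (\<phi> q base) (u i)"
    unfolding eventually_sequentially by blast
qed

text \<open>By properness some orbit points near the ray are far from \<open>base\<close>, hence
  near \<open>\<rho> t\<close> with \<open>t\<close> large. Seen from the origin of the ray,
  \<open>\<rho> t\<close> and any later ray point have product exactly \<open>t\<close>.\<close>

lemma orbit_limit_conical:
  assumes ray: "geodesic_ray \<rho>" and seq: "(\<lambda>n. \<rho> (real n)) \<in> gromov_sequences"
    and inf: "infinite {g \<in> carrier G. \<exists>t\<ge>0. dist (\<phi> g x) (\<rho> t) \<le> R}"
  shows "orbit_limit (\<lambda>n. \<rho> (real n))"
  unfolding orbit_limit_def
proof (intro conjI seq allI)
  fix r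
  define o' where "o' = \<rho> 0"
  \<comment> \<open>\<open>R'\<close> replaces the orbit of \<open>x\<close> by that of
    \<open>base\<close>. The margin in \<open>far\<close> pays twice for \<open>R'\<close> and
    \<open>dist base o'\<close>: once to make \<open>t\<close> large, once to return from
    \<open>\<rho> t\<close> and \<open>o'\<close> to \<open>\<phi> g base\<close> and
    \<open>base\<close>.\<close>
  define R' where "R' = R + dist base x"
  obtain g t where g: "g \<in> carrier G" and t: "t \<ge> 0" "dist (\<phi> g x) (\<rho> t) \<le> R"
    and far: "r + 2 * R' + 2 * dist base o' < dist base (\<phi> g base)"
    using infinite_displacement[OF inf, of "r + 2 * R' + 2 * dist base o'"] by blast
  have near: "dist (\<phi> g base) (\<rho> t) \<le> R'"
    using dist_triangle[of "\<phi> g base" "\<rho> t" "\<phi> g x"] t g by (simp add: R'_def dist_action)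
  have ray_dist: "dist (\<rho> a) (\<rho> b) = \<bar>a - b\<bar>" if "a \<ge> 0" "b \<ge> 0" for a b
    using ray that unfolding geodesic_ray_def by blast
  have "dist base (\<phi> g base) \<le> dist base o' + t + R'"
    using dist_triangle[of base "\<phi> g base" o'] dist_triangle[of o' "\<phi> g base" "\<rho> t"] near
      ray_dist[of 0 t] t by (simp add: o'_def dist_commute)
  then have large: "r + R' + dist base o' \<le> t"
    using far by linarith
  have "r \<le> gromov_product base (\<phi> g base) (\<rho> (real i))" if "real i \<ge> t" for i
  proof -
    have "gromov_product o' (\<rho> t) (\<rho> (real i)) = t"
      using ray_dist[of 0 t] ray_dist[of t "real i"] ray_dist[of 0 "real i"] that t
      by (simp add: gromov_product_def o'_def)
    then show ?thesis
      using gromov_product_lipschitz[of o' "\<rho> t" "\<rho> (real i)" "\<phi> g base"] near large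
        gromov_product_base[of o' "\<phi> g base" "\<rho> (real i)" base]
      by linarith
  qed
  then have "\<forall>\<^sub>F i in sequentially. r \<le> gromov_product base (\<phi> g base) (\<rho> (real i))"
    using eventually_sequentiallyI[of "nat \<lceil>t\<rceil>"] by (metis nat_ceiling_le_eq)
  with g show "\<exists>g\<in>carrier G. \<forall>\<^sub>F i in sequentially. r \<le> gromov_product base (\<phi> g base) (\<rho> (real i))"
    by blast
qed

text \<open>An infinite set contains elements of large displacement; by the dichotomy such an
  element or its inverse supplies the orbit point.\<close>

lemma orbit_limit_infinite_stabilizer:
  assumes u: "u \<in> gromov_sequences" and Q: "infinite Q" "Q \<subseteq> carrier G"
    and fixed: "\<And>q. q \<in> Q \<Longrightarrow> converge_together u (\<phi> q \<circ> u)"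
  shows "orbit_limit u"
  unfolding orbit_limit_def
proof (intro conjI u allI)
  fix r
  obtain q where q: "q \<in> Q" "2 * r + \<delta> < dist base (\<phi> q base)"
    using infinite_displacement[OF Q] .
  then have "q \<in> carrier G" "inv q \<in> carrier G"
    using Q by auto
  then show "\<exists>g\<in>carrier G. \<forall>\<^sub>F i in sequentially. r \<le> gromov_product base (\<phi> g base) (u i)"
    using fixed_point_dichotomy[OF _ fixed q(2)] q(1) by blast
qed

section \<open>Central elements and stabilizers of boundary points\<close>

lemma commuting_fixes_limit:
  assumes u: "orbit_limit u" and z: "z \<in> carrier G"
    and comm: "\<And>g. g \<in> carrier G \<Longrightarrow> z \<otimes> g = g \<otimes> z"
  shows "converge_together u (\<phi> z \<circ> u)"
  unfolding converge_together_iff[of _ _ base]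
proof
  fix r
  define D where "D = dist base (\<phi> z base)"
  have D0: "D \<ge> 0" by (simp add: D_def)
  obtain g N where g: "g \<in> carrier G"
    and N: "\<And>i. i \<ge> N \<Longrightarrow> r + 2 * \<delta> + D \<le> gromov_product base (\<phi> g base) (u i)"
    using u unfolding orbit_limit_def eventually_sequentially by meson
  define p where "p = \<phi> g base"
  \<comment> \<open>Commuting with \<open>g\<close>, the element \<open>z\<close> moves
    \<open>p\<close> exactly as far as \<open>base\<close>. So \<open>p\<close> and
    \<open>\<phi> z p\<close> stay close however far out \<open>p\<close> lies, and link
    \<open>u i\<close> to \<open>\<phi> z (u j)\<close> at the cost of two \<delta>.\<close>
  have near: "dist p (\<phi> z p) = D"
    using g z comm[OF g] by (simp add: p_def D_def dist_action flip: action_mult)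
      (simp add: action_mult dist_action)
  have "r \<le> gromov_product base (u i) (\<phi> z (u j))" if ij: "i \<ge> N" "j \<ge> N" for i j
  proof -
    have 1: "r + 2 * \<delta> \<le> gromov_product base (u i) p"
      using N[OF ij(1)] D0 gromov_product_commute[of base p] by (simp add: p_def)
    have "dist base p \<ge> r + 2 * \<delta> + D"
      using N[OF ij(1)] gromov_product_le_dist[of base p "u i"] by (simp add: p_def)
    then have 2: "r + 2 * \<delta> \<le> gromov_product base p (\<phi> z p)"
      using near dist_triangle[of base p "\<phi> z p"] by (simp add: gromov_product_def dist_commute)
    have 3: "r + 2 * \<delta> \<le> gromov_product base (\<phi> z p) (\<phi> z (u j))"
      using gromov_product_base[of "\<phi> z base" "\<phi> z p" "\<phi> z (u j)" base] N[OF ij(2)] z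
      by (simp add: D_def p_def gromov_product_action)
    have "r + \<delta> \<le> gromov_product base (u i) (\<phi> z p)"
      using hyperbolic[of base "u i" p "\<phi> z p"] 1 2 by linarith
    then show ?thesis
      using hyperbolic[of base "u i" "\<phi> z p" "\<phi> z (u j)"] 3 delta_nonneg by linarith
  qed
  then show "\<exists>N. \<forall>i\<ge>N. \<forall>j\<ge>N. r \<le> gromov_product base (u i) ((\<phi> z \<circ> u) j)"
    by auto
qed

text \<open>For an element of large displacement, each of the three limits is approached by the
  image of \<open>base\<close> under it or under its inverse. Two limits then share an orbit point,
  against their distinctness.\<close>

lemma finite_stabilizer_of_three_points:
  assumes A: "A \<subseteq> carrier G"
    and fixed: "\<And>z. z \<in> A \<Longrightarrow> converge_together u (\<phi> z \<circ> u) \<and> converge_together v (\<phi> z \<circ> v) \<and>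
                  converge_together w (\<phi> z \<circ> w)"
    and distinct: "\<not> converge_together u v" "\<not> converge_together v w" "\<not> converge_together u w"
  shows "finite A"
proof (rule ccontr)
  assume inf: "infinite A"
  define P where "P r y u \<longleftrightarrow> (\<forall>\<^sub>F i in sequentially. r \<le> gromov_product base y (u i))" for r y u
  have P_mono: "P s y u" if "P r y u" "s \<le> r" for r s y u
    using that unfolding P_def by (auto elim: eventually_mono)
  obtain r1 r2 r3 where r: "\<And>y. \<not> (P r1 y u \<and> P r1 y v)" "\<And>y. \<not> (P r2 y v \<and> P r2 y w)"
    "\<And>y. \<not> (P r3 y u \<and> P r3 y w)"
    using distinct converge_together_if_common_points unfolding P_def by metis
  define r where "r = max r1 (max r2 r3)"
  have le: "r1 \<le> r" "r2 \<le> r" "r3 \<le> r"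
    by (auto simp: r_def)
  obtain z where z: "z \<in> A" "2 * r + \<delta> < dist base (\<phi> z base)"
    using infinite_displacement[OF inf A] .
  then have "P r (\<phi> z base) x \<or> P r (\<phi> (inv z) base) x" if "x \<in> {u, v, w}" for x
    using fixed_point_dichotomy[of z x r] fixed A that unfolding P_def by blast
  then show False
    using r P_mono le by (metis insertCI)
qed

section \<open>Boundary points outside the limit set of \<open>H\<close>\<close>

lemma not_limit_bounded_product:
  assumes u: "u \<in> \<xi>" "\<xi> \<in> gromov_boundary" and nl: "\<xi> \<notin> limit_set \<phi> H"
  shows "\<exists>M. \<forall>h\<in>H. \<forall>y. (\<forall>\<^sub>F i in sequentially. M \<le> gromov_product base y (u i)) \<longrightarrow>
           gromov_product base (\<phi> h base) y \<le> M"
proof -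
  \<comment> \<open>If no \<open>M\<close> worked, elements \<open>h n\<close> with products
    eventually at least \<open>n\<close> would give an orbit sequence in \<xi>, placing \<xi> in the
    limit set.\<close>
  have "\<exists>M. \<forall>h\<in>H. \<not> (\<forall>\<^sub>F i in sequentially. M \<le> gromov_product base (\<phi> h base) (u i))"
  proof (rule ccontr)
    assume "\<not> ?thesis"
    then have "\<exists>h. \<forall>n. h n \<in> H \<and> (\<forall>\<^sub>F i in sequentially. real n \<le> gromov_product base (\<phi> (h n) base) (u i))"
      by (intro choice) blast
    then obtain h where h: "\<And>n. h n \<in> H"
      "\<And>n. \<forall>\<^sub>F i in sequentially. real n \<le> gromov_product base (\<phi> (h n) base) (u i)"
      by blast
    have "u \<in> gromov_sequences"
      using gromov_boundary_member_iff[OF u(2,1)] u by simp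
    from converge_together_if_approached[OF this h(2)] have "(\<lambda>n. \<phi> (h n) base) \<in> \<xi>"
      using gromov_boundary_member_iff[OF u(2,1)] by simp
    then have "\<xi> \<in> limit_set \<phi> H"
      unfolding limit_set_def using u h(1) by blast
    with nl show False ..
  qed
  then obtain M where M: "\<And>h. h \<in> H \<Longrightarrow> \<not> (\<forall>\<^sub>F i in sequentially. M \<le> gromov_product base (\<phi> h base) (u i))"
    by blast
  have "gromov_product base (\<phi> h base) y \<le> M + \<delta>"
    if h: "h \<in> H" and ev: "\<forall>\<^sub>F i in sequentially. M + \<delta> \<le> gromov_product base y (u i)" for h y
  proof (rule ccontr)
    assume less: "\<not> gromov_product base (\<phi> h base) y \<le> M + \<delta>"
    from ev have "\<forall>\<^sub>F i in sequentially. M \<le> gromov_product base (\<phi> h base) (u i)"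
    proof (rule eventually_mono)
      fix i assume "M + \<delta> \<le> gromov_product base y (u i)"
      then show "M \<le> gromov_product base (\<phi> h base) (u i)"
        using hyperbolic[of base "\<phi> h base" y "u i"] less by linarith
    qed
    with M[OF h] show False ..
  qed
  then show ?thesis by blast
qed

text \<open>Seen from \<open>p\<close>, all of \<open>H base\<close> lies close to \<open>base\<close>, and all of \<open>tH base\<close> close to \<open>t base\<close>.
  Elements of \<open>H \<inter> tHt\<^sup>-\<^sup>1\<close> of large displacement force these two regions to meet.\<close>

lemma displacement_bound:
  assumes H: "H \<subseteq> carrier G" and t: "t \<in> carrier G"
    and inf: "infinite (H \<inter> (\<lambda>h. t \<otimes> h \<otimes> inv t) ` H)"
    and M: "\<And>h. h \<in> H \<Longrightarrow> gromov_product base (\<phi> h base) p \<le> M"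
  shows "dist base (\<phi> t base) \<le> 2 * M + 3 * dist p (\<phi> t p) + 4 * \<delta>"
proof -
  define D where "D = dist base p"
  define F where "F = dist p (\<phi> t p)"
  define b where "b = \<phi> t base"
  have seen: "D - M \<le> gromov_product p (\<phi> h base) base" if "h \<in> H" for h
    using M[OF that] gromov_product_swap[of base p "\<phi> h base"]
      gromov_product_commute[of base p "\<phi> h base"] gromov_product_commute[of p base "\<phi> h base"]
      dist_commute[of base p]
    unfolding D_def by linarith
  \<comment> \<open>The threshold ensures that \<open>\<phi> k base\<close> and
    \<open>\<phi> k b\<close>, at distance \<open>dist base b\<close>, have product at least
    \<open>D\<close> seen from \<open>p\<close>.\<close>
  obtain k where k: "k \<in> H" "k \<in> (\<lambda>h. t \<otimes> h \<otimes> inv t) ` H"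
    and far: "2 * D + dist base b < dist base (\<phi> k base)"
    using infinite_displacement[OF inf, of "2 * D + dist base b"] H by blast
  obtain h where h: "h \<in> H" "k = t \<otimes> h \<otimes> inv t"
    using k by blast
  have kG: "k \<in> carrier G" and hG: "h \<in> carrier G"
    using h k H by auto
  \<comment> \<open>Thus \<open>k\<close> sends \<open>b\<close> to
    \<open>\<phi> t (\<phi> h base)\<close>, whose product with \<open>b\<close> is known when seen
    from \<open>\<phi> t p\<close>.\<close>
  have "k \<otimes> t = t \<otimes> h"
    using h(2) t hG by (simp add: m_assoc)
  then have kb: "\<phi> k b = \<phi> t (\<phi> h base)"
    using kG hG t by (simp add: b_def flip: action_mult)
  have "gromov_product (\<phi> t p) (\<phi> k b) b = gromov_product p (\<phi> h base) base"
    using t by (simp add: kb) (simp add: b_def gromov_product_action)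
  then have 3: "D - M - F \<le> gromov_product p (\<phi> k b) b"
    using seen[OF h(1)] gromov_product_base[of "\<phi> t p" "\<phi> k b" b p] by (simp add: F_def)
  have 1: "D - M \<le> gromov_product p base (\<phi> k base)"
    using seen[OF k(1)] by (simp add: gromov_product_commute)
  have "M \<ge> 0"
    using 1 gromov_product_le_dist[of p base "\<phi> k base"] by (simp add: D_def dist_commute)
  have "dist (\<phi> k base) (\<phi> k b) = dist base b"
    using kG by (simp add: dist_action)
  then have 2: "D \<le> gromov_product p (\<phi> k base) (\<phi> k b)"
    using far dist_triangle[of base "\<phi> k base" p] dist_triangle[of p "\<phi> k base" "\<phi> k b"]
    by (simp add: gromov_product_def D_def dist_commute)
  have F0: "F \<ge> 0" by (simp add: F_def)
  \<comment> \<open>The chain \<open>base\<close>, \<open>\<phi> k base\<close>,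
    \<open>\<phi> k b\<close>, \<open>b\<close> takes two applications of hyperbolicity at
    \<open>p\<close>. A large product of \<open>base\<close> and \<open>b\<close> there bounds their
    distance.\<close>
  have "D - M - \<delta> \<le> gromov_product p base (\<phi> k b)"
    using hyperbolic[of p base "\<phi> k base" "\<phi> k b"] 1 2 \<open>M \<ge> 0\<close> by linarith
  then have "D - M - F - 2 * \<delta> \<le> gromov_product p base b"
    using hyperbolic[of p base "\<phi> k b" b] 3 F0 delta_nonneg by linarith
  moreover have "dist p b \<le> D + F"
    using dist_triangle[of p b "\<phi> t p"] t
    by (simp add: b_def F_def D_def dist_action dist_commute)
  ultimately show ?thesis
    by (simp add: gromov_product_def D_def F_def b_def dist_commute)
qed

end

section \<open>A conjugate with finite intersection\<close>

text \<open>Closed balls are compact, and an element displacing the center by at most the radius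
  sends the ball to one meeting it; proper discontinuity leaves finitely many.\<close>

lemma hyperbolic_action_of_relatively_hyperbolic:
  fixes \<phi> :: "'g \<Rightarrow> 'x::metric_space \<Rightarrow> 'x" and b :: 'x
  assumes "relatively_hyperbolic_via G \<P> \<phi>"
  obtains \<delta> where "hyperbolic_action G \<delta> b \<phi>"
proof -
  have G: "group G" and proper: "\<And>(x::'x) r. compact (cball x r)"
    and hyp: "hyperbolic_space TYPE('x)"
    and act: "group_action G UNIV \<phi>"
    and isom: "\<And>g x y. g \<in> carrier G \<Longrightarrow> dist (\<phi> g x) (\<phi> g y) = dist x y"
    and pd: "\<And>K. compact K \<Longrightarrow> finite {g \<in> carrier G. \<phi> g ` K \<inter> K \<noteq> {}}"
    using assms unfolding relatively_hyperbolic_via_def isometric_pd_action_def proper_space_def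
    by auto
  obtain \<delta> where \<delta>: "\<And>b x y z :: 'x.
      min (gromov_product b x y) (gromov_product b y z) - \<delta> \<le> gromov_product b x z"
    using hyp unfolding hyperbolic_space_def by blast
  have "finite {g \<in> carrier G. dist x (\<phi> g x) \<le> r}" for x r
  proof (rule finite_subset)
    show "{g \<in> carrier G. dist x (\<phi> g x) \<le> r} \<subseteq> {g \<in> carrier G. \<phi> g ` cball x r \<inter> cball x r \<noteq> {}}"
    proof safe
      fix g assume g: "dist x (\<phi> g x) \<le> r" "\<phi> g ` cball x r \<inter> cball x r = {}"
      have "0 \<le> r" using g(1) zero_le_dist order_trans by blast
      then have "\<phi> g x \<in> \<phi> g ` cball x r \<inter> cball x r"
        using g by (intro IntI imageI) auto
      with g show False by blast
    qed
    show "finite {g \<in> carrier G. \<phi> g ` cball x r \<inter> cball x r \<noteq> {}}"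
      by (rule pd[OF proper])
  qed
  moreover have "\<phi> \<one>\<^bsub>G\<^esub> x = x" for x
    using group_action.id_eq_one[OF act] by (metis UNIV_I restrict_apply)
  moreover have "\<phi> (g \<otimes>\<^bsub>G\<^esub> h) x = \<phi> g (\<phi> h x)" if "g \<in> carrier G" "h \<in> carrier G" for g h x
    using group_action.composition_rule[OF act] that by simp
  ultimately have "hyperbolic_action G \<delta> b \<phi>"
    using G \<delta> isom
    by (intro hyperbolic_action.intro hyperbolic_metric.intro hyperbolic_action_axioms.intro) auto
  then show ?thesis ..
qed

context hyperbolic_action
begin

lemma boundary_point_orbit_limit:
  fixes \<xi> :: "(nat \<Rightarrow> 'x) set"
  assumes \<xi>: "\<xi> \<in> gromov_boundary"
    and types: "conical_limit_point G \<phi> \<xi> \<or> bounded_parabolic_point G \<phi> \<xi>"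
  obtains u where "u \<in> \<xi>" "orbit_limit u"
  using types
proof
  assume "conical_limit_point G \<phi> \<xi>"
  then obtain \<rho> x R where \<rho>: "geodesic_ray \<rho>" "(\<lambda>n. \<rho> (real n)) \<in> \<xi>"
    and inf: "infinite {g \<in> carrier G. \<exists>t\<ge>0. dist (\<phi> g x) (\<rho> t) \<le> R}"
    unfolding conical_limit_point_def by blast
  have "(\<lambda>n. \<rho> (real n)) \<in> gromov_sequences"
    using gromov_boundary_member_iff[OF \<xi> \<rho>(2)] \<rho>(2) by blast
  from that[OF \<rho>(2) orbit_limit_conical[OF \<rho>(1) this inf]] show thesis .
next
  assume "bounded_parabolic_point G \<phi> \<xi>"
  define Q where "Q = stabilizer G (\<lambda>g. boundary_map (\<phi> g)) \<xi>"
  have Q: "infinite Q" "Q \<subseteq> carrier G"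
    using \<open>bounded_parabolic_point G \<phi> \<xi>\<close>
    unfolding bounded_parabolic_point_def parabolic_subgroup_def Let_def Q_def stabilizer_def by auto
  obtain u where u: "u \<in> \<xi>"
    using gromov_boundary_nonempty[OF \<xi>] .
  have "converge_together u (\<phi> q \<circ> u)" if "q \<in> Q" for q
  proof -
    have "boundary_map (\<phi> q) \<xi> = \<xi>"
      using that unfolding Q_def stabilizer_def by blast
    then have "\<phi> q \<circ> u \<in> \<xi>"
      using u unfolding boundary_map_def by blast
    then show ?thesis
      using gromov_boundary_member_iff[OF \<xi> u] by blast
  qed
  moreover have "u \<in> gromov_sequences"
    using gromov_boundary_member_iff[OF \<xi> u] u by blast
  ultimately show thesis
    using that[OF u] orbit_limit_infinite_stabilizer[OF _ Q] by blast
qed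

lemma commutes_with_generated:
  assumes S: "S \<subseteq> carrier G" and z: "z \<in> carrier G" and comm: "\<And>s. s \<in> S \<Longrightarrow> z \<otimes> s = s \<otimes> z"
    and g: "g \<in> generate G S"
  shows "z \<otimes> g = g \<otimes> z"
  using g
proof (induction rule: generate.induct)
  case (inv h)
  then have "h \<in> carrier G" using S by blast
  then show ?case
    using comm[OF inv] z by (metis inv_closed inv_solve_left inv_solve_right' m_assoc m_closed)
next
  case (eng h1 h2)
  then have "h1 \<in> carrier G" "h2 \<in> carrier G"
    using generate_in_carrier[OF S] by blast+
  then show ?case
    using eng z by (metis m_assoc)
qed (use comm z in auto)

lemma exists_finite_conjugate_intersection:
  fixes \<xi> \<xi>1 \<xi>2 \<xi>3 :: "(nat \<Rightarrow> 'x) set"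
  assumes types: "\<And>\<xi> :: (nat \<Rightarrow> 'x) set. \<xi> \<in> gromov_boundary \<Longrightarrow>
                    conical_limit_point G \<phi> \<xi> \<or> bounded_parabolic_point G \<phi> \<xi>"
    and three: "\<xi>1 \<in> gromov_boundary" "\<xi>2 \<in> gromov_boundary" "\<xi>3 \<in> gromov_boundary"
      "\<xi>1 \<noteq> \<xi>2" "\<xi>2 \<noteq> \<xi>3" "\<xi>1 \<noteq> \<xi>3"
    and S: "finite_symmetric_generating_set G S"
    and H: "subgroup H G"
    and \<xi>: "\<xi> \<in> gromov_boundary" "\<xi> \<notin> limit_set \<phi> H"
  shows "\<exists>t\<in>carrier G. finite (H \<inter> (\<lambda>h. t \<otimes> h \<otimes> inv t) ` H)"
proof (rule ccontr)
  assume "\<not> ?thesis"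
  then have inf: "\<And>t. t \<in> carrier G \<Longrightarrow> infinite (H \<inter> (\<lambda>h. t \<otimes> h \<otimes> inv t) ` H)"
    by blast
  have finS: "finite S" and SG: "S \<subseteq> carrier G" and gen: "generate G S = carrier G"
    using S unfolding finite_symmetric_generating_set_def by auto
  obtain u where u: "u \<in> \<xi>" "orbit_limit u"
    using boundary_point_orbit_limit[OF \<xi>(1) types[OF \<xi>(1)]] .
  obtain M where M: "\<And>h y. h \<in> H \<Longrightarrow> \<forall>\<^sub>F i in sequentially. M \<le> gromov_product base y (u i) \<Longrightarrow>
      gromov_product base (\<phi> h base) y \<le> M"
    using not_limit_bounded_product[OF u(1) \<xi>] by blast
  define A where "A = {g \<in> carrier G. \<forall>\<^sub>F i in sequentially. M \<le> gromov_product base (\<phi> g base) (u i)}"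
  have AG: "A \<subseteq> carrier G"
    by (auto simp: A_def)
  have infA: "infinite A"
  proof
    assume fin: "finite A"
    \<comment> \<open>\<open>r\<close> exceeds every displacement on \<open>A\<close>, yet a product
      with \<open>\<phi> g base\<close> is at most the displacement of \<open>g\<close>. The
      \<open>max\<close> with \<open>M\<close> puts \<open>g\<close> into \<open>A\<close>.\<close>
    define r where "r = max M (Max ((\<lambda>g. dist base (\<phi> g base)) ` A) + 1)"
    obtain g where g: "g \<in> carrier G" "\<forall>\<^sub>F i in sequentially. r \<le> gromov_product base (\<phi> g base) (u i)"
      using u(2) unfolding orbit_limit_def by blast
    have "g \<in> A"
      using g unfolding A_def by (auto simp: r_def elim: eventually_mono)
    then have "dist base (\<phi> g base) \<le> Max ((\<lambda>g. dist base (\<phi> g base)) ` A)"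
      using fin by simp
    moreover obtain i where "r \<le> gromov_product base (\<phi> g base) (u i)"
      using g(2) unfolding eventually_sequentially by blast
    ultimately show False
      using gromov_product_le_dist[of base "\<phi> g base" "u i"] by (simp add: r_def)
  qed
  \<comment> \<open>Restriction to \<open>S\<close> makes each tuple of conjugates an extensional
    function, so that all lie in the finite set \<open>PiE S N\<close>.\<close>
  define conj where "conj g = (\<lambda>s\<in>S. g \<otimes> s \<otimes> inv g)" for g
  define N where "N s = {t \<in> carrier G. dist base (\<phi> t base) \<le> 2 * M + 3 * dist base (\<phi> s base) + 4 * \<delta>}" for s
  have "conj g \<in> PiE S N" if g: "g \<in> A" for g
    unfolding conj_def
  proof (rule PiE_I)
    fix s assume s: "s \<in> S"
    define t where "t = g \<otimes> s \<otimes> inv g"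
    have gG: "g \<in> carrier G" and sG: "s \<in> carrier G"
      using g s AG SG by auto
    have tG: "t \<in> carrier G"
      using gG sG by (simp add: t_def)
    \<comment> \<open>The conjugate \<open>t\<close> moves \<open>\<phi> g base\<close> as far as
      \<open>s\<close> moves \<open>base\<close>, so the displacement bound with
      \<open>p = \<phi> g base\<close> is independent of \<open>g\<close>.\<close>
    have "\<phi> t (\<phi> g base) = \<phi> g (\<phi> s base)"
      using gG sG by (simp add: t_def m_assoc flip: action_mult)
    then have "dist (\<phi> g base) (\<phi> t (\<phi> g base)) = dist base (\<phi> s base)"
      using gG by (simp add: dist_action)
    moreover have "dist base (\<phi> t base) \<le> 2 * M + 3 * dist (\<phi> g base) (\<phi> t (\<phi> g base)) + 4 * \<delta>"
      using g M by (intro displacement_bound[OF subgroup.subset[OF H] tG inf[OF tG]]) (auto simp: A_def)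
    ultimately show "(\<lambda>s\<in>S. g \<otimes> s \<otimes> inv g) s \<in> N s"
      using s tG by (simp add: N_def t_def)
  qed simp
  moreover have "finite (PiE S N)"
    using finS finite_displacement by (intro finite_PiE) (auto simp: N_def)
  ultimately have "finite (conj ` A)"
    by (meson finite_subset image_subsetI)
  then obtain c where c: "infinite {g \<in> A. conj g = c}"
    using pigeonhole_infinite[OF infA] by (metis (mono_tags))
  define B where "B = {g \<in> A. conj g = c}"
  have B: "infinite B" "B \<subseteq> carrier G"
    using c AG unfolding B_def by auto
  obtain g0 where g0: "g0 \<in> B"
    using B(1) by (metis ex_in_conv finite.emptyI)
  \<comment> \<open>Elements giving the same conjugates of all generators differ by elements
    commuting with \<open>S\<close>, hence with all of \<open>G\<close>.\<close>
  define Z where "Z = (\<lambda>g. inv g0 \<otimes> g) ` B"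
  have g0G: "g0 \<in> carrier G" using g0 B by blast
  have "inj_on (\<lambda>g. inv g0 \<otimes> g) B"
    using B(2) g0G by (auto intro!: inj_onI simp: subset_iff)
  then have infZ: "infinite Z"
    using B(1) unfolding Z_def by (simp add: finite_image_iff)
  have ZG: "Z \<subseteq> carrier G"
    using B(2) g0G unfolding Z_def by auto
  have comm: "z \<otimes> g = g \<otimes> z" if z: "z \<in> Z" and g: "g \<in> carrier G" for z g
  proof (rule commutes_with_generated[OF SG])
    show "z \<in> carrier G" using z ZG by blast
    show "g \<in> generate G S" using g gen by simp
    fix s assume s: "s \<in> S"
    then have sG: "s \<in> carrier G" using SG by blast
    obtain g where g: "g \<in> B" "z = inv g0 \<otimes> g"
      using z unfolding Z_def by blast
    have gG: "g \<in> carrier G" using g B by blast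
    have "conj g s = conj g0 s"
      using g g0 unfolding B_def by simp
    then have eq: "g \<otimes> s \<otimes> inv g = g0 \<otimes> s \<otimes> inv g0"
      using s by (simp add: conj_def)
    have "g \<otimes> s = g \<otimes> s \<otimes> inv g \<otimes> g"
      using gG sG by (simp add: m_assoc)
    also have "\<dots> = g0 \<otimes> s \<otimes> z"
      using gG sG g0G g(2) by (simp add: eq m_assoc)
    finally have "inv g0 \<otimes> (g \<otimes> s) = inv g0 \<otimes> (g0 \<otimes> s \<otimes> z)"
      by simp
    then show "z \<otimes> s = s \<otimes> z"
      using gG sG g0G g(2) by (simp flip: m_assoc)
  qed
  obtain u1 u2 u3 where lims: "u1 \<in> \<xi>1" "orbit_limit u1" "u2 \<in> \<xi>2" "orbit_limit u2"
    "u3 \<in> \<xi>3" "orbit_limit u3"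
    using boundary_point_orbit_limit types three(1-3) by metis
  have "finite Z"
  proof (rule finite_stabilizer_of_three_points[OF ZG])
    show "converge_together u1 (\<phi> z \<circ> u1) \<and> converge_together u2 (\<phi> z \<circ> u2) \<and>
        converge_together u3 (\<phi> z \<circ> u3)" if "z \<in> Z" for z
      using that ZG lims comm by (auto intro!: commuting_fixes_limit)
  qed (use gromov_boundary_eqI three lims in metis)+
  with infZ show False ..
qed

end

lemma obtain_three_distinct:
  assumes "infinite A \<or> card A > 2"
  obtains a b c where "a \<in> A" "b \<in> A" "c \<in> A" "a \<noteq> b" "b \<noteq> c" "a \<noteq> c"
proof -
  obtain B where B: "B \<subseteq> A" "card B = 3"
    using assms by (metis infinite_arbitrarily_large obtain_subset_with_card_n Suc_leI numeral_3_eq_3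
      numeral_2_eq_2)
  then show ?thesis
    using that unfolding card_3_iff by blast
qed

theorem corollary3p20:
  fixes G :: "('g, 'm) monoid_scheme"
    and \<P> :: "'g set set"
    and \<phi> :: "'g \<Rightarrow> 'x::metric_space \<Rightarrow> 'x"
    and S H :: "'g set"
  assumes "relatively_hyperbolic_via G \<P> \<phi>"
    and "non_elementary \<phi>"
    and "finite_symmetric_generating_set G S"
    and "subgroup H G"
    and "limit_set \<phi> H \<subset> bowditch_boundary \<phi>"
    and "relative_growth G S H > 1"
  shows "\<not> SLC_subexp G S H"
proof
  assume SLC: "SLC_subexp G S H"
  \<comment> \<open>Any base point serves; \<open>undefined\<close> merely names a point of the
    space.\<close>
  obtain \<delta> where "hyperbolic_action G \<delta> undefined \<phi>"
    using hyperbolic_action_of_relatively_hyperbolic[OF assms(1)] .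
  then interpret hyperbolic_action G \<delta> undefined \<phi> .
  have types: "\<And>\<xi>. \<xi> \<in> gromov_boundary \<Longrightarrow>
      conical_limit_point G \<phi> \<xi> \<or> bounded_parabolic_point G \<phi> \<xi>"
    using assms(1) unfolding relatively_hyperbolic_via_def by blast
  obtain \<xi>1 \<xi>2 \<xi>3 :: "(nat \<Rightarrow> 'x) set" where three: "\<xi>1 \<in> gromov_boundary" "\<xi>2 \<in> gromov_boundary"
    "\<xi>3 \<in> gromov_boundary" "\<xi>1 \<noteq> \<xi>2" "\<xi>2 \<noteq> \<xi>3" "\<xi>1 \<noteq> \<xi>3"
    using assms(2) obtain_three_distinct unfolding non_elementary_def bowditch_boundary_def by metis
  obtain \<xi> where "\<xi> \<in> gromov_boundary" "\<xi> \<notin> limit_set \<phi> H"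
    using assms(5) unfolding bowditch_boundary_def by blast
  then obtain t where "t \<in> carrier G" "finite (H \<inter> (\<lambda>h. t \<otimes>\<^bsub>G\<^esub> h \<otimes>\<^bsub>G\<^esub> inv\<^bsub>G\<^esub> t) ` H)"
    using exists_finite_conjugate_intersection[OF types three assms(3,4)] by blast
  then have "relative_growth G S H \<le> 1"
    using SLC_subexp_imp_subexponential_growth[OF assms(3,4)] SLC by blast
  with assms(6) show False by simp
qed

end
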